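(* For $\theta=(K,\lambda_1,\dots,\lambda_K)\in\Theta$, write $\overline V=V(\theta)=V_{1,\lambda_1}+\dots+V_{K,\lambda_K}$ and $\delta=\delta(\theta)$. For all product probabilities $\mathbf P=P_1\otimes\dots\otimes P_n$ on $(\mathscr X^n,\mathcal X^{\otimes n})$ and all $\overline P\in\mathscr P$, the $\rho$-dimension admits the bound $$D^{\mathscr Q_\delta(\theta)}\left(\mathbf P,\overline P^{\otimes n}\right)\le818.1\,\overline V\left[5.82+\log\left(\frac{(K+1)^2}{\delta}\right)+\log_+\left(\frac n{\overline V}\right)\right].$$
   Context: $\mathscr P$ is the set of probabilities on $(\mathscr X,\mathcal X)$. $h^2(Q,Q')=\frac12\int(\sqrt{dQ/d\nu}-\sqrt{dQ'/d\nu})^2d\nu$ and $\mathbf h^2(\bigotimes_iQ_i,\bigotimes_iQ_i')=\sum_{i=1}^nh^2(Q_i,Q_i')$. $\log_+(x)=\max(\log x,0)$. The VC-index of a class of functions is the smallest integer $m\ge1$ such that no $m$-point set is shattered by the subgraphs $\{(x,t):t<f(x)\}$; the class is VC-subgraph if this is finite. Models. For $k\ge1$, $\Lambda_k$ is at most countable; for $\lambda\in\Lambda_k$, $\overline{\mathscr F}_{k,\lambda}\subset\mathscr P$ contains an at most countable Hellinger-dense subset $\mathscr F_{k,\lambda}$; $\mu$ is a $\sigma$-finite measure dominating all of them and $\overline{\mathscr F}_{k,\lambda}=\{f\cdot\mu:f\in\overline{\mathcal F}_{k,\lambda}\}$, where $\overline{\mathcal F}_{k,\lambda}$ is VC-subgraph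 with VC-index $V_{k,\lambda}\ge1$. $\Theta$ is a subset of $\bigcup_{K\ge1}\{K\}\times\prod_{k=1}^K\Lambda_k$, and $\delta:\Theta\to(0,1]$ satisfies $\delta(\theta)\in(0,1/K]$ for $\theta=(K,\lambda_1,\dots,\lambda_K)$. $\mathscr Q_\delta(\theta)=\{\sum_{k=1}^Kw_kF_k:w_k\in[\delta(\theta),1]\cap\mathbb Q,\ \sum_kw_k=1,\ F_k\in\mathscr F_{k,\lambda_k}\}$. $\rho$-dimension (Baraud and Birgé). Let $\psi(x)=\frac{x-1}{x+1}$ on $[0,+\infty]$ ($\psi(+\infty)=1$), $a_1=3/8$, $a_2^2=3\sqrt2$, $\beta=a_1/(4a_2)$. For an at most countable $\mathscr Q\subset\mathscr P$, $\overline P\in\mathscr P$ and densities $\overline p,q$ of $\overline P$, $Q\in\mathscr Q$ with respect to a common dominating measure, let $\mathbf T(\mathbf X,\overline p,q)=\sum_{i=1}^n\psi\big(\sqrt{q(X_i)/\overline p(X_i)}\big)$ (with $0/0=1$, $a/0=+\infty$ for $a>0$). For $y>0$, $$\mathbf w^{\mathscr Q}(\mathbf P,\overline P^{\otimes n},y)=\mathbb E\left[\sup\left|\mathbf T(\mathbf X,\overline p,q)-\mathbb E[\mathbf T(\mathbf X,\overline p,q)]\right|\right],$$ where $\mathbf X\sim\mathbf P$ and the supremum is over $Q\in\mathscr Q$ with $\mathbf h^2(\mathbf P,\overline P^{\otimes n})+\mathbf h^2(\mathbf P,Q^{\otimes n})<y^2$ ($\sup\emptyset=0$). Then $$D^{\mathscr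 Q}(\mathbf P,\overline P^{\otimes n})=\left[\beta^2\sup\left\{y^2:\ y>0,\ \mathbf w^{\mathscr Q}(\mathbf P,\overline P^{\otimes n},y)>\frac{a_1y^2}8\right\}\right]\vee1.$$
   Formalization: Since the ρ-dimension depends on density versions where the dominating measure misses P, and the bound fails for arbitrary versions, the densities q of the mixtures are required to equal, P_i-almost everywhere, Σ w_k f_k with f_k in the model's density classes, times a factor common to all Q. *)

theory Defs
  imports "HOL-Probability.Probability"
begin

text \<open>Throughout, the set of probabilities on the measurable space underlying \<^term>\<open>\<mu>\<close>
  is \<^term>\<open>space (prob_algebra \<mu>)\<close>.\<close>

definition add_measure :: "'a measure \<Rightarrow> 'a measure \<Rightarrow> 'a measure" where
  "add_measure Q R = measure_of (space Q) (sets Q) (\<lambda>A. emeasure Q A + emeasure R A)"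

text \<open>Squared Hellinger distance. The dominating measure is \<open>Q + R\<close>; by \<open>hellinger_sq_density\<close>
  below the value is the same for every \<open>\<sigma>\<close>-finite dominating measure.\<close>

definition hellinger_sq :: "'a measure \<Rightarrow> 'a measure \<Rightarrow> real" where
  "hellinger_sq Q R =
     (let \<nu> = add_measure Q R in
      (1 / 2) * (\<integral>x. (sqrt (enn2real (RN_deriv \<nu> Q x)) - sqrt (enn2real (RN_deriv \<nu> R x)))\<^sup>2 \<partial>\<nu>))"

definition hellinger :: "'a measure \<Rightarrow> 'a measure \<Rightarrow> real" where
  "hellinger Q R = sqrt (hellinger_sq Q R)"

text \<open>Families \<open>P, R\<close> of \<open>n\<close> marginals (indices \<open>i < n\<close>) stand for the product probabilities
  \<open>P 0 \<otimes> \<dots> \<otimes> P (n - 1)\<close> and \<open>R 0 \<otimes> \<dots> \<otimes> R (n - 1)\<close>.\<close>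

definition prod_hellinger_sq :: "nat \<Rightarrow> (nat \<Rightarrow> 'a measure) \<Rightarrow> (nat \<Rightarrow> 'a measure) \<Rightarrow> real" where
  "prod_hellinger_sq n P R = (\<Sum>i<n. hellinger_sq (P i) (R i))"

definition hellinger_dense :: "'a measure set \<Rightarrow> 'a measure set \<Rightarrow> bool" where
  "hellinger_dense D \<M> \<longleftrightarrow> D \<subseteq> \<M> \<and> (\<forall>Q\<in>\<M>. \<forall>\<epsilon>>0. \<exists>R\<in>D. hellinger Q R < \<epsilon>)"

definition log_plus :: "real \<Rightarrow> real" where
  "log_plus x = max (ln x) 0"

definition is_density :: "'a measure \<Rightarrow> 'a measure \<Rightarrow> ('a \<Rightarrow> real) \<Rightarrow> bool" where
  "is_density \<nu> Q q \<longleftrightarrow> q \<in> borel_measurable \<nu> \<and> (\<forall>x\<in>space \<nu>. 0 \<le> q x) \<and> Q = density \<nu> q"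


subsection \<open>VC-subgraph classes\<close>

definition subgraph :: "'a set \<Rightarrow> ('a \<Rightarrow> real) \<Rightarrow> ('a \<times> real) set" where
  "subgraph S f = {(x, t). x \<in> S \<and> t < f x}"

definition shatters :: "'b set set \<Rightarrow> 'b set \<Rightarrow> bool" where
  "shatters \<C> A \<longleftrightarrow> (\<forall>B\<subseteq>A. \<exists>C\<in>\<C>. A \<inter> C = B)"

definition shatters_none_of_size :: "'b set set \<Rightarrow> nat \<Rightarrow> bool" where
  "shatters_none_of_size \<C> m \<longleftrightarrow> \<not> (\<exists>A. finite A \<and> card A = m \<and> shatters \<C> A)"

definition vc_subgraph :: "'a set \<Rightarrow> ('a \<Rightarrow> real) set \<Rightarrow> bool" where
  "vc_subgraph S \<F> \<longleftrightarrow> (\<exists>m\<ge>1. shatters_none_of_size (subgraph S ` \<F>) m)"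

text \<open>Meaningful only if \<^term>\<open>vc_subgraph S \<F>\<close>.\<close>

definition vc_index :: "'a set \<Rightarrow> ('a \<Rightarrow> real) set \<Rightarrow> nat" where
  "vc_index S \<F> = (LEAST m. 1 \<le> m \<and> shatters_none_of_size (subgraph S ` \<F>) m)"


subsection \<open>Mixture models\<close>

definition mixture :: "'a measure \<Rightarrow> nat \<Rightarrow> (nat \<Rightarrow> real) \<Rightarrow> (nat \<Rightarrow> 'a measure) \<Rightarrow> 'a measure" where
  "mixture \<mu> K w G =
     measure_of (space \<mu>) (sets \<mu>) (\<lambda>A. \<Sum>k=1..K. ennreal (w k) * emeasure (G k) A)"

definition rational_weights :: "real \<Rightarrow> nat \<Rightarrow> (nat \<Rightarrow> real) set" where
  "rational_weights d K = {w. (\<forall>k\<in>{1..K}. w k \<in> {d..1} \<inter> \<rat>) \<and> (\<Sum>k=1..K. w k) = 1}"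

definition mixture_model ::
  "'a measure \<Rightarrow> (nat \<Rightarrow> 'l \<Rightarrow> 'a measure set) \<Rightarrow> (nat \<times> (nat \<Rightarrow> 'l) \<Rightarrow> real) \<Rightarrow>
    nat \<times> (nat \<Rightarrow> 'l) \<Rightarrow> 'a measure set" where
  "mixture_model \<mu> F \<delta> = (\<lambda>(K, l).
     {mixture \<mu> K w G | w G.
        w \<in> rational_weights (\<delta> (K, l)) K \<and> (\<forall>k\<in>{1..K}. G k \<in> F k (l k))})"

text \<open>Outside the support of the dominating measure the densities \<open>q Q\<close> of the members \<open>Q\<close> of a
  mixture model could be chosen arbitrarily, while the probabilities \<open>P i\<close> may charge that set.
  The following predicate says that \<open>P i\<close>-almost everywhere the densities come from the classes
  \<open>\<F> k (l k)\<close> of densities with respect to \<open>\<mu>\<close>, up to a factor \<open>g\<close> common to all \<open>Q\<close> (which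
  is \<open>d\<mu>/d\<nu>\<close> for densities with respect to \<open>\<nu>\<close>). By \<open>model_densitiesI\<close> below
  it holds for arbitrary densities if the dominating measure also dominates \<open>\<mu>\<close> and the
  \<open>P i\<close>.\<close>

definition model_densities ::
  "'a measure \<Rightarrow> (nat \<Rightarrow> 'l \<Rightarrow> ('a \<Rightarrow> real) set) \<Rightarrow> (nat \<Rightarrow> 'l \<Rightarrow> 'a measure set) \<Rightarrow>
    (nat \<times> (nat \<Rightarrow> 'l) \<Rightarrow> real) \<Rightarrow> nat \<times> (nat \<Rightarrow> 'l) \<Rightarrow>
    nat \<Rightarrow> (nat \<Rightarrow> 'a measure) \<Rightarrow> ('a measure \<Rightarrow> 'a \<Rightarrow> real) \<Rightarrow> bool" where
  "model_densities \<mu> \<F> F \<delta> = (\<lambda>(K, l) n P q.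
     \<exists>g\<in>borel_measurable \<mu>. (\<forall>x\<in>space \<mu>. 0 \<le> g x) \<and>
       (\<forall>Q\<in>mixture_model \<mu> F \<delta> (K, l). \<exists>w\<in>rational_weights (\<delta> (K, l)) K. \<exists>f.
          (\<forall>k\<in>{1..K}. f k \<in> \<F> k (l k) \<and> density \<mu> (f k) \<in> F k (l k)) \<and>
          Q = mixture \<mu> K w (\<lambda>k. density \<mu> (f k)) \<and>
          (\<forall>i<n. AE x in P i. q Q x = g x * (\<Sum>k=1..K. w k * f k x))))"


subsection \<open>The rho-dimension\<close>

definition rho_psi :: "ennreal \<Rightarrow> real" where
  "rho_psi x = (if x = \<infinity> then 1 else (enn2real x - 1) / (enn2real x + 1))"

definition sqrt_ratio :: "real \<Rightarrow> real \<Rightarrow> ennreal" where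
  "sqrt_ratio a b = (if b = 0 then (if a = 0 then 1 else \<infinity>) else ennreal (sqrt (a / b)))"

definition rho_a1 :: real where "rho_a1 = 3 / 8"
definition rho_a2 :: real where "rho_a2 = sqrt (3 * sqrt 2)"
definition rho_beta :: real where "rho_beta = rho_a1 / (4 * rho_a2)"

definition rho_T :: "nat \<Rightarrow> ('a \<Rightarrow> real) \<Rightarrow> ('a \<Rightarrow> real) \<Rightarrow> (nat \<Rightarrow> 'a) \<Rightarrow> real" where
  "rho_T n p q X = (\<Sum>i<n. rho_psi (sqrt_ratio (q (X i)) (p (X i))))"

text \<open>Here \<open>Pbar\<close> comes with its density \<open>p\<close>, and each \<open>Q \<in> \<Q>\<close> with its density \<open>q Q\<close>.
  Suprema are taken in \<^typ>\<open>ennreal\<close>, where \<open>sup \<emptyset> = 0\<close>.\<close>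

definition rho_w ::
  "nat \<Rightarrow> (nat \<Rightarrow> 'a measure) \<Rightarrow> 'a measure \<Rightarrow> ('a \<Rightarrow> real) \<Rightarrow>
    'a measure set \<Rightarrow> ('a measure \<Rightarrow> 'a \<Rightarrow> real) \<Rightarrow> real \<Rightarrow> ennreal" where
  "rho_w n P Pbar p \<Q> q y =
     (\<integral>\<^sup>+X. (SUP Q\<in>{Q\<in>\<Q>. prod_hellinger_sq n P (\<lambda>_. Pbar) + prod_hellinger_sq n P (\<lambda>_. Q) < y\<^sup>2}.
        ennreal \<bar>rho_T n p (q Q) X - (\<integral>X'. rho_T n p (q Q) X' \<partial>PiM {..<n} P)\<bar>) \<partial>PiM {..<n} P)"

definition rho_dim ::
  "nat \<Rightarrow> (nat \<Rightarrow> 'a measure) \<Rightarrow> 'a measure \<Rightarrow> ('a \<Rightarrow> real) \<Rightarrow>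
    'a measure set \<Rightarrow> ('a measure \<Rightarrow> 'a \<Rightarrow> real) \<Rightarrow> ennreal" where
  "rho_dim n P Pbar p \<Q> q =
     max (ennreal (rho_beta\<^sup>2) *
            Sup {ennreal (y\<^sup>2) | y. 0 < y \<and> rho_w n P Pbar p \<Q> q y > ennreal (rho_a1 * y\<^sup>2 / 8)})
         1"


subsection \<open>Sanity lemmas\<close>

lemma sets_add_measure [simp]: "sets (add_measure Q R) = sets Q"
  and space_add_measure [simp]: "space (add_measure Q R) = space Q"
  by (simp_all add: add_measure_def)

lemma emeasure_add_measure:
  assumes "sets R = sets Q" "A \<in> sets Q"
  shows "emeasure (add_measure Q R) A = emeasure Q A + emeasure R A"
proof (rule emeasure_measure_of[OF add_measure_def])
  show "countably_additive (sets (add_measure Q R)) (\<lambda>A. emeasure Q A + emeasure R A)"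
  proof (rule countably_additiveI)
    fix A :: "nat \<Rightarrow> 'a set"
    assume A: "range A \<subseteq> sets (add_measure Q R)" "disjoint_family A"
    then have "(\<Sum>i. emeasure Q (A i)) = emeasure Q (\<Union>i. A i)"
      and "(\<Sum>i. emeasure R (A i)) = emeasure R (\<Union>i. A i)"
      using assms by (auto intro!: suminf_emeasure)
    then show "(\<Sum>i. emeasure Q (A i) + emeasure R (A i)) = emeasure Q (\<Union>i. A i) + emeasure R (\<Union>i. A i)"
      by (subst suminf_add[symmetric]) auto
  qed
qed (use assms sets.sets_into_space in \<open>auto simp: positive_def\<close>)

lemma sets_mixture [simp]: "sets (mixture \<mu> K w G) = sets \<mu>"
  and space_mixture [simp]: "space (mixture \<mu> K w G) = space \<mu>"
  by (simp_all add: mixture_def)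

lemma emeasure_mixture:
  assumes "\<And>k. k \<in> {1..K} \<Longrightarrow> sets (G k) = sets \<mu>" "A \<in> sets \<mu>"
  shows "emeasure (mixture \<mu> K w G) A = (\<Sum>k=1..K. ennreal (w k) * emeasure (G k) A)"
proof (rule emeasure_measure_of[OF mixture_def])
  show "countably_additive (sets (mixture \<mu> K w G)) (\<lambda>A. \<Sum>k=1..K. ennreal (w k) * emeasure (G k) A)"
  proof (rule countably_additiveI)
    fix A :: "nat \<Rightarrow> 'a set"
    assume A: "range A \<subseteq> sets (mixture \<mu> K w G)" "disjoint_family A"
    then have *: "(\<Sum>i. emeasure (G k) (A i)) = emeasure (G k) (\<Union>i. A i)" if "k \<in> {1..K}" for k
      using assms(1)[OF that] by (auto intro!: suminf_emeasure)
    have "(\<Sum>i. \<Sum>k=1..K. ennreal (w k) * emeasure (G k) (A i))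
        = (\<Sum>k=1..K. \<Sum>i. ennreal (w k) * emeasure (G k) (A i))"
      by (rule suminf_sum) auto
    also have "\<dots> = (\<Sum>k=1..K. ennreal (w k) * emeasure (G k) (\<Union>i. A i))"
      by (rule sum.cong[OF refl]) (use * in simp)
    finally show "(\<Sum>i. \<Sum>k=1..K. ennreal (w k) * emeasure (G k) (A i))
        = (\<Sum>k=1..K. ennreal (w k) * emeasure (G k) (\<Union>i. A i))" .
  qed
qed (use assms sets.sets_into_space[of _ \<mu>] in \<open>auto simp: positive_def\<close>)

lemma mixture_density:
  fixes f :: "nat \<Rightarrow> 'a \<Rightarrow> real"
  assumes f: "\<And>k. k \<in> {1..K} \<Longrightarrow> f k \<in> borel_measurable \<mu>"
    and f0: "\<And>k x. k \<in> {1..K} \<Longrightarrow> x \<in> space \<mu> \<Longrightarrow> 0 \<le> f k x"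
    and w0: "\<And>k. k \<in> {1..K} \<Longrightarrow> 0 \<le> w k"
  shows "mixture \<mu> K w (\<lambda>k. density \<mu> (f k)) = density \<mu> (\<lambda>x. \<Sum>k=1..K. w k * f k x)"
proof (rule measure_eqI)
  fix A assume "A \<in> sets (mixture \<mu> K w (\<lambda>k. density \<mu> (f k)))"
  then have A: "A \<in> sets \<mu>" by simp
  have "emeasure (density \<mu> (\<lambda>x. \<Sum>k=1..K. w k * f k x)) A
      = (\<integral>\<^sup>+x. (\<Sum>k=1..K. ennreal (w k) * (ennreal (f k x) * indicator A x)) \<partial>\<mu>)"
  proof -
    have "ennreal (\<Sum>k=1..K. w k * f k x) * indicator A x
        = (\<Sum>k=1..K. ennreal (w k) * (ennreal (f k x) * indicator A x))" if x: "x \<in> space \<mu>" for x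
    proof -
      have "ennreal (\<Sum>k=1..K. w k * f k x) = (\<Sum>k=1..K. ennreal (w k * f k x))"
        using f0[OF _ x] w0 by (intro sum_ennreal[symmetric] mult_nonneg_nonneg) auto
      also have "\<dots> = (\<Sum>k=1..K. ennreal (w k) * ennreal (f k x))"
        using f0[OF _ x] w0 by (intro sum.cong refl ennreal_mult) auto
      finally show ?thesis by (simp add: sum_distrib_right mult.assoc)
    qed
    moreover have "(\<lambda>x. ennreal (\<Sum>k=1..K. w k * f k x)) \<in> borel_measurable \<mu>"
      using f by (intro measurable_compose[OF _ measurable_ennreal] borel_measurable_sum
          borel_measurable_times) auto
    ultimately show ?thesis
      using A by (subst emeasure_density) (auto intro!: nn_integral_cong)
  qed
  also have "\<dots> = (\<Sum>k=1..K. ennreal (w k) * (\<integral>\<^sup>+x. ennreal (f k x) * indicator A x \<partial>\<mu>))"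
    using A f
    by (subst nn_integral_sum) (auto intro!: sum.cong nn_integral_cmult)
  also have "\<dots> = emeasure (mixture \<mu> K w (\<lambda>k. density \<mu> (f k))) A"
    using A f by (subst emeasure_mixture) (auto intro!: sum.cong simp: emeasure_density)
  finally show "emeasure (mixture \<mu> K w (\<lambda>k. density \<mu> (f k))) A
      = emeasure (density \<mu> (\<lambda>x. \<Sum>k=1..K. w k * f k x)) A" ..
qed simp

lemma hellinger_sq_density:
  fixes f g :: "'a \<Rightarrow> real"
  assumes \<nu>: "sigma_finite_measure \<nu>"
    and f: "is_density \<nu> Q f" and g: "is_density \<nu> R g"
    and fin: "finite_measure Q" "finite_measure R"
  shows "hellinger_sq Q R = (1 / 2) * (\<integral>x. (sqrt (f x) - sqrt (g x))\<^sup>2 \<partial>\<nu>)"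
proof -
  have [measurable]: "f \<in> borel_measurable \<nu>" "g \<in> borel_measurable \<nu>"
    and f0: "\<And>x. x \<in> space \<nu> \<Longrightarrow> 0 \<le> f x" and g0: "\<And>x. x \<in> space \<nu> \<Longrightarrow> 0 \<le> g x"
    and Q: "Q = density \<nu> f" and R: "R = density \<nu> g"
    using f g by (auto simp: is_density_def)
  define s where "s x = f x + g x" for x
  have [measurable]: "s \<in> borel_measurable \<nu>" unfolding s_def by measurable
  define N where "N = add_measure Q R"
  have N: "N = density \<nu> s"
  proof (rule measure_eqI)
    fix A assume "A \<in> sets N"
    then have A[measurable]: "A \<in> sets \<nu>" by (simp add: N_def Q)
    have "emeasure N A = emeasure Q A + emeasure R A"
      unfolding N_def using A by (subst emeasure_add_measure) (auto simp: Q R)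
    also have "\<dots> = (\<integral>\<^sup>+x. ennreal (f x) * indicator A x + ennreal (g x) * indicator A x \<partial>\<nu>)"
      by (simp add: Q R emeasure_density nn_integral_add)
    also have "\<dots> = emeasure (density \<nu> s) A"
      using f0 g0 by (auto simp: emeasure_density s_def distrib_right intro!: nn_integral_cong)
    finally show "emeasure N A = emeasure (density \<nu> s) A" .
  qed (simp add: N_def Q)
  have finN: "finite_measure N"
  proof (rule finite_measureI)
    have "emeasure Q (space \<nu>) \<noteq> \<infinity>" "emeasure R (space \<nu>) \<noteq> \<infinity>"
      using finite_measure.emeasure_finite[OF fin(1)] finite_measure.emeasure_finite[OF fin(2)]
      by (auto simp: Q R)
    then show "emeasure N (space N) \<noteq> \<infinity>"
      unfolding N_def by (subst emeasure_add_measure) (auto simp: Q R)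
  qed
  interpret N: finite_measure N by fact
  have [measurable_cong]: "sets N = sets \<nu>" by (simp add: N)
  have deriv: "AE x in \<nu>. s x * (sqrt (enn2real (RN_deriv N M x)) - sqrt (h x / s x))\<^sup>2 = 0"
    if M: "M = density \<nu> h" and [measurable]: "h \<in> borel_measurable \<nu>"
      and h: "\<And>x. x \<in> space \<nu> \<Longrightarrow> 0 \<le> h x \<and> h x \<le> s x" for M and h :: "'a \<Rightarrow> real"
  proof -
    have "density N (\<lambda>x. ennreal (h x / s x)) = M"
    proof -
      have "density N (\<lambda>x. ennreal (h x / s x)) = density \<nu> (\<lambda>x. ennreal (s x) * ennreal (h x / s x))"
        unfolding N by (subst density_density_eq) auto
      also have "\<dots> = density \<nu> h"
      proof (rule density_cong)
        show "AE x in \<nu>. ennreal (s x) * ennreal (h x / s x) = ennreal (h x)"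
        proof (rule AE_I2)
          fix x assume x: "x \<in> space \<nu>"
          have "s x * (h x / s x) = h x" using h[OF x] by (cases "s x = 0") auto
          then show "ennreal (s x) * ennreal (h x / s x) = ennreal (h x)"
            using h[OF x] by (subst ennreal_mult[symmetric]) auto
        qed
      qed auto
      finally show ?thesis by (simp add: M)
    qed
    then have "AE x in N. ennreal (h x / s x) = RN_deriv N M x"
      by (intro N.RN_deriv_unique) auto
    then have "AE x in \<nu>. ennreal (s x) > 0 \<longrightarrow> ennreal (h x / s x) = RN_deriv N M x"
      unfolding N by (subst (asm) AE_density) auto
    then show ?thesis
    proof (rule AE_mp, intro AE_I2 impI)
      fix x assume x: "x \<in> space \<nu>"
        and *: "ennreal (s x) > 0 \<longrightarrow> ennreal (h x / s x) = RN_deriv N M x"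
      show "s x * (sqrt (enn2real (RN_deriv N M x)) - sqrt (h x / s x))\<^sup>2 = 0"
      proof (cases "s x = 0")
        case False
        then have "s x > 0" using h[OF x] by linarith
        then have "RN_deriv N M x = ennreal (h x / s x)" using * by simp
        then show ?thesis using h[OF x] by simp
      qed simp
    qed
  qed
  have dQ: "AE x in \<nu>. s x * (sqrt (enn2real (RN_deriv N Q x)) - sqrt (f x / s x))\<^sup>2 = 0"
    using f0 g0 by (intro deriv) (auto simp: Q s_def)
  have dR: "AE x in \<nu>. s x * (sqrt (enn2real (RN_deriv N R x)) - sqrt (g x / s x))\<^sup>2 = 0"
    using f0 g0 by (intro deriv) (auto simp: R s_def)
  have "(\<integral>x. (sqrt (enn2real (RN_deriv N Q x)) - sqrt (enn2real (RN_deriv N R x)))\<^sup>2 \<partial>N)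
      = (\<integral>x. s x *\<^sub>R (sqrt (enn2real (RN_deriv N Q x)) - sqrt (enn2real (RN_deriv N R x)))\<^sup>2 \<partial>\<nu>)"
  proof -
    have [measurable]: "RN_deriv N Q \<in> borel_measurable \<nu>" "RN_deriv N R \<in> borel_measurable \<nu>"
      using borel_measurable_RN_deriv[of N Q] borel_measurable_RN_deriv[of N R]
        measurable_cong_sets[OF \<open>sets N = sets \<nu>\<close> refl, of borel] by auto
    have s0: "\<And>x. x \<in> space \<nu> \<Longrightarrow> 0 \<le> s x" using f0 g0 by (simp add: s_def)
    show ?thesis
      using integral_density[of "\<lambda>x. (sqrt (enn2real (RN_deriv N Q x)) - sqrt (enn2real (RN_deriv N R x)))\<^sup>2" \<nu> s]
        s0 by (simp add: N[symmetric])
  qed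
  also have "\<dots> = (\<integral>x. (sqrt (f x) - sqrt (g x))\<^sup>2 \<partial>\<nu>)"
  proof (rule integral_cong_AE)
    show "AE x in \<nu>. s x *\<^sub>R (sqrt (enn2real (RN_deriv N Q x)) - sqrt (enn2real (RN_deriv N R x)))\<^sup>2
        = (sqrt (f x) - sqrt (g x))\<^sup>2"
      using dQ dR AE_space[of \<nu>]
    proof eventually_elim
      case (elim x)
      show ?case
      proof (cases "s x = 0")
        case True
        then have "f x = 0" "g x = 0" using f0[OF elim(3)] g0[OF elim(3)] by (auto simp: s_def)
        then show ?thesis using True by simp
      next
        case False
        then have s: "s x > 0" using f0[OF elim(3)] g0[OF elim(3)] by (simp add: s_def)
        have "s x * (sqrt (f x / s x) - sqrt (g x / s x))\<^sup>2 = (sqrt (f x) - sqrt (g x))\<^sup>2"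
          using s by (simp add: real_sqrt_divide diff_divide_distrib[symmetric] power_divide)
        then show ?thesis using elim s by auto
      qed
    qed
  qed (use borel_measurable_RN_deriv[of N Q] borel_measurable_RN_deriv[of N R]
        measurable_cong_sets[OF \<open>sets N = sets \<nu>\<close> refl, of borel] in measurable)
  finally show ?thesis by (simp add: hellinger_sq_def Let_def N_def[symmetric])
qed

lemma model_densitiesI:
  fixes g :: "'a \<Rightarrow> real"
  assumes \<nu>: "sigma_finite_measure \<nu>" and g: "is_density \<nu> \<mu> g"
    and P: "\<And>i. i < n \<Longrightarrow> absolutely_continuous \<nu> (P i)" "\<And>i. i < n \<Longrightarrow> sets (P i) = sets \<nu>"
    and \<F>: "\<And>k f. k \<in> {1..K} \<Longrightarrow> f \<in> \<F> k (l k) \<Longrightarrow>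
               f \<in> borel_measurable \<mu> \<and> (\<forall>x\<in>space \<mu>. 0 \<le> f x)"
    and F: "\<And>k. k \<in> {1..K} \<Longrightarrow> F k (l k) \<subseteq> {density \<mu> f | f. f \<in> \<F> k (l k)}"
    and \<delta>: "0 \<le> \<delta> (K, l)"
    and q: "\<And>Q. Q \<in> mixture_model \<mu> F \<delta> (K, l) \<Longrightarrow> is_density \<nu> Q (q Q)"
  shows "model_densities \<mu> \<F> F \<delta> (K, l) n P q"
proof -
  have [measurable]: "g \<in> borel_measurable \<nu>" and g0: "\<And>x. x \<in> space \<nu> \<Longrightarrow> 0 \<le> g x"
    and \<mu>: "\<mu> = density \<nu> g"
    using g by (auto simp: is_density_def)
  have [measurable_cong]: "sets \<mu> = sets \<nu>" and sp: "space \<mu> = space \<nu>" by (simp_all add: \<mu>)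
  have "\<exists>w\<in>rational_weights (\<delta> (K, l)) K. \<exists>f.
          (\<forall>k\<in>{1..K}. f k \<in> \<F> k (l k) \<and> density \<mu> (f k) \<in> F k (l k)) \<and>
          Q = mixture \<mu> K w (\<lambda>k. density \<mu> (f k)) \<and>
          (\<forall>i<n. AE x in P i. q Q x = g x * (\<Sum>k=1..K. w k * f k x))"
    if Q: "Q \<in> mixture_model \<mu> F \<delta> (K, l)" for Q
  proof -
    obtain w G where w: "w \<in> rational_weights (\<delta> (K, l)) K" and G: "\<forall>k\<in>{1..K}. G k \<in> F k (l k)"
      and QG: "Q = mixture \<mu> K w G"
      using Q by (auto simp: mixture_model_def)
    have "\<forall>k\<in>{1..K}. \<exists>f. f \<in> \<F> k (l k) \<and> G k = density \<mu> f" using F G by blast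
    then obtain f where f: "\<forall>k\<in>{1..K}. f k \<in> \<F> k (l k) \<and> G k = density \<mu> (f k)" by metis
    have w0: "0 \<le> w k" if "k \<in> {1..K}" for k
      using w that \<delta> order_trans[of 0 "\<delta> (K, l)" "w k"] by (auto simp: rational_weights_def)
    have fm: "f k \<in> borel_measurable \<mu>" "\<And>x. x \<in> space \<mu> \<Longrightarrow> 0 \<le> f k x" if "k \<in> {1..K}" for k
      using \<F> f that by blast+
    define m where "m x = (\<Sum>k=1..K. w k * f k x)" for x
    have [measurable]: "m \<in> borel_measurable \<nu>"
      using fm(1) measurable_cong_sets[OF \<open>sets \<mu> = sets \<nu>\<close> refl, of borel]
      unfolding m_def by (intro borel_measurable_sum borel_measurable_times) auto
    have m0: "0 \<le> m x" if "x \<in> space \<nu>" for x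
      unfolding m_def using that fm(2) w0 by (intro sum_nonneg mult_nonneg_nonneg) (auto simp: sp)
    have Qf: "Q = mixture \<mu> K w (\<lambda>k. density \<mu> (f k))"
      unfolding QG mixture_def using f by (intro arg_cong[where f="measure_of _ _"] ext sum.cong) auto
    also have "\<dots> = density \<mu> m"
      unfolding m_def by (rule mixture_density) (use fm w0 in auto)
    also have "\<dots> = density \<nu> (\<lambda>x. ennreal (g x) * ennreal (m x))"
      unfolding \<mu> by (rule density_density_eq) auto
    also have "\<dots> = density \<nu> (\<lambda>x. g x * m x)"
      by (rule density_cong) (use g0 m0 in \<open>auto simp: ennreal_mult\<close>)
    finally have "density \<nu> (q Q) = density \<nu> (\<lambda>x. g x * m x)"
      using q[OF Q] by (simp add: is_density_def)
    moreover have [measurable]: "q Q \<in> borel_measurable \<nu>" and q0: "\<And>x. x \<in> space \<nu> \<Longrightarrow> 0 \<le> q Q x"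
      using q[OF Q] by (auto simp: is_density_def)
    ultimately have "AE x in \<nu>. ennreal (q Q x) = ennreal (g x * m x)"
      by (subst (asm) sigma_finite_measure.density_unique_iff[OF \<nu>]) auto
    then have ae: "AE x in \<nu>. q Q x = g x * m x"
      using AE_space[of \<nu>] by eventually_elim (use q0 g0 m0 in auto)
    have "AE x in P i. q Q x = g x * m x" if "i < n" for i
      using absolutely_continuous_AE[OF P(2)[OF that] P(1)[OF that] ae] .
    then show ?thesis using w f G Qf by (intro bexI[of _ w] exI[of _ f]) (auto simp: m_def)
  qed
  then show ?thesis
    unfolding model_densities_def using g0 by (auto simp: sp intro!: bexI[of _ g])
qed

end

theory Submission
  imports Defs
begin

text \<open>
  The claim is that the expected supremum \<open>w(y)\<close> of the centred process is at most
  \<open>a\<^sub>1 y\<^sup>2 / 8 = 3 y\<^sup>2 / 64\<close> as soon as \<open>\<beta>\<^sup>2 y\<^sup>2\<close> exceeds the bound, which up to a factor is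
  \<open>V L\<close>, with \<open>L = 5.82 + ln ((K + 1)\<^sup>2 / \<delta>) + log\<^sub>+ (n / V)\<close>. The numerical constant leaves
  enough room for a single discretization of the class.

  Write \<open>h\<^sub>Q = \<psi> (sqrt (q / p))\<close>, with values in \<open>[- 1, 1]\<close>. On any \<open>n\<close> sample points the functions
  \<open>h\<^sub>Q\<close> can be grouped into \<open>N\<close> classes inside which they differ by at most \<open>\<epsilon> = 1 / max 1 (n / V)\<close>
  at every point (\<open>mixture_scores_has_net\<close>). A density \<open>f\<^sub>k\<close> matters only through its comparison
  with finitely many thresholds at each point: the score sees \<open>q / p\<close> on a scale where both small
  and large values saturate, and, the weights being at least \<open>\<delta>\<close>, a single large term
  already makes the whole mixture large. The Sauer-Shelah argument (\<open>card_traces_le\<close>) counts the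
  comparison patterns of each component, the weights are rounded to multiples of \<open>\<epsilon> \<delta>\<close>, and
  the outcome is \<open>ln (2 N) \<le> 6 V L\<close>.

  Symmetrization (\<open>symmetrization\<close>) followed by the exponential moment of Rademacher sums
  (\<open>rademacher_sup_bound\<close>) bounds \<open>w(y)\<close>, for every \<open>\<kappa> > 0\<close>, by
  \<open>2 n \<epsilon> + 2 ln (2 N) / \<kappa> + \<kappa> \<Gamma>\<close>, where \<open>\<Gamma>\<close> is the expected supremum of \<open>\<Sum>\<^sub>i h\<^sub>Q(X\<^sub>i)\<^sup>2\<close>.
  The same inequality for the squares \<open>h\<^sub>Q\<^sup>2\<close>, with \<open>\<kappa> = 1/2\<close>, has at most \<open>\<Gamma> / 2\<close> on its right-hand
  side, so that \<open>\<Gamma>\<close> is controlled by the largest second moment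
  (\<open>expected_sup_deviation_variance\<close>). That moment is at most \<open>2 y\<^sup>2\<close>, because
  \<open>E\<^sub>P h\<^sub>Q\<^sup>2 \<le> 2 (h\<^sup>2(P, Pbar) + h\<^sup>2(P, Q))\<close> (\<open>score_second_moment_le\<close>), which is where the
  Hellinger localization enters.

  With \<open>\<kappa> = 1/128\<close> the second moments cost \<open>y\<^sup>2 / 32\<close>, and the remaining \<open>y\<^sup>2 / 64\<close> absorbs
  all terms of order \<open>V L\<close>.
\<close>

section \<open>Rademacher sums over finite nets\<close>

text \<open>A vector of signs indexed by \<open>I\<close> is encoded by the set \<open>S \<subseteq> I\<close> of the indices with sign
  \<open>+ 1\<close>; averaging over independent fair signs is summing over \<^term>\<open>Pow I\<close> and dividing by
  \<open>2 ^ card I\<close>.\<close>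

definition rademacher :: "'i set \<Rightarrow> 'i \<Rightarrow> real" where
  "rademacher S i = (if i \<in> S then 1 else - 1)"

lemma sum_Pow_insert:
  fixes F :: "'i set \<Rightarrow> 'b::comm_monoid_add"
  assumes "finite I" "i \<notin> I"
  shows "(\<Sum>S\<in>Pow (insert i I). F S) = (\<Sum>S\<in>Pow I. F S + F (insert i S))"
proof -
  have inj: "inj_on (insert i) (Pow I)"
    using assms(2) by (auto simp: inj_on_def)
  have "(\<Sum>S\<in>Pow (insert i I). F S) = (\<Sum>S\<in>Pow I. F S) + (\<Sum>S\<in>insert i ` Pow I. F S)"
    unfolding Pow_insert using assms by (intro sum.union_disjoint) auto
  also have "(\<Sum>S\<in>insert i ` Pow I. F S) = (\<Sum>S\<in>Pow I. F (insert i S))"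
    by (simp add: sum.reindex[OF inj])
  finally show ?thesis by (simp add: sum.distrib)
qed

lemma rademacher_sum_insert:
  assumes "finite I" "i \<notin> I" "S \<subseteq> I"
  shows "(\<Sum>j\<in>insert i I. rademacher S j * a j) = - a i + (\<Sum>j\<in>I. rademacher S j * a j)"
    and "(\<Sum>j\<in>insert i I. rademacher (insert i S) j * a j) = a i + (\<Sum>j\<in>I. rademacher S j * a j)"
proof -
  show "(\<Sum>j\<in>insert i I. rademacher S j * a j) = - a i + (\<Sum>j\<in>I. rademacher S j * a j)"
    using assms by (auto simp: rademacher_def)
  have "(\<Sum>j\<in>I. rademacher (insert i S) j * a j) = (\<Sum>j\<in>I. rademacher S j * a j)"
    using assms by (intro sum.cong) (auto simp: rademacher_def)
  then show "(\<Sum>j\<in>insert i I. rademacher (insert i S) j * a j) = a i + (\<Sum>j\<in>I. rademacher S j * a j)"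
    using assms by (simp add: rademacher_def)
qed

text \<open>Hoeffding's lemma for a fair sign, taken from the analytic inequality behind the general case.\<close>

lemma cosh_le_exp_half_square: "cosh x \<le> exp (x\<^sup>2 / 2)" for x :: real
proof -
  have pos: "cosh x \<le> exp (x\<^sup>2 / 2)" if "0 \<le> x" for x :: real
  proof -
    have "- (2 * x) * (1 / 2) + ln (1 + (1 / 2) * (exp (2 * x) - 1)) \<le> (2 * x)\<^sup>2 / 8"
      using that by (intro Hoeffdings_lemma_aux) auto
    then have "ln ((1 + exp (2 * x)) / 2) \<le> x + x\<^sup>2 / 2"
      by (simp add: field_simps power2_eq_square)
    then have "(1 + exp (2 * x)) / 2 \<le> exp (x + x\<^sup>2 / 2)"
      by (metis add_pos_pos exp_gt_zero exp_le_cancel_iff exp_ln half_gt_zero zero_less_one)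
    moreover have "(1 + exp (2 * x)) / 2 = exp x * cosh x"
      by (simp add: cosh_def field_simps exp_minus mult_exp_exp)
    ultimately show ?thesis by (simp add: exp_add)
  qed
  show ?thesis using pos[of x] pos[of "- x"] by (cases "0 \<le> x") auto
qed

text \<open>A Rademacher sum is sub-Gaussian with variance factor \<open>\<Sum>\<^sub>i a\<^sub>i\<^sup>2\<close>: the signs factorize, and each of
  them contributes a factor \<^term>\<open>cosh (a i)\<close>.\<close>

lemma rademacher_exp_moment:
  assumes "finite I"
  shows "(\<Sum>S\<in>Pow I. exp (\<Sum>i\<in>I. rademacher S i * a i)) \<le> 2 ^ card I * exp ((\<Sum>i\<in>I. (a i)\<^sup>2) / 2)"
  using assms
proof (induction I)
  case (insert i I)
  have "(\<Sum>S\<in>Pow (insert i I). exp (\<Sum>i\<in>insert i I. rademacher S i * a i))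
      = (\<Sum>S\<in>Pow I. 2 * cosh (a i) * exp (\<Sum>i\<in>I. rademacher S i * a i))"
    unfolding sum_Pow_insert[OF insert(1,2)]
  proof (rule sum.cong[OF refl])
    fix S assume "S \<in> Pow I"
    then show "exp (\<Sum>i\<in>insert i I. rademacher S i * a i)
          + exp (\<Sum>j\<in>insert i I. rademacher (insert i S) j * a j)
        = 2 * cosh (a i) * exp (\<Sum>i\<in>I. rademacher S i * a i)"
      using rademacher_sum_insert[OF insert(1,2), of S a]
      by (simp only: Pow_iff exp_add) (simp add: cosh_def algebra_simps)
  qed
  also have "\<dots> = 2 * cosh (a i) * (\<Sum>S\<in>Pow I. exp (\<Sum>i\<in>I. rademacher S i * a i))"
    by (simp add: sum_distrib_left)
  also have "\<dots> \<le> 2 * exp ((a i)\<^sup>2 / 2) * (2 ^ card I * exp ((\<Sum>i\<in>I. (a i)\<^sup>2) / 2))"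
    using insert.IH cosh_le_exp_half_square[of "a i"]
    by (intro mult_mono) (auto intro!: sum_nonneg)
  also have "\<dots> = 2 ^ card (insert i I) * exp ((\<Sum>i\<in>insert i I. (a i)\<^sup>2) / 2)"
    using insert(1,2) by (simp add: exp_add add_divide_distrib)
  finally show ?case .
qed simp

text \<open>The net consists of members of \<open>H\<close>, so that bounds on the members of \<open>H\<close> carry over to it.
  The size is compared with a real number, since only upper estimates of it are ever known.\<close>

definition has_net :: "'h set \<Rightarrow> ('h \<Rightarrow> 'i \<Rightarrow> real) \<Rightarrow> 'i set \<Rightarrow> real \<Rightarrow> real \<Rightarrow> bool" where
  "has_net H a I \<epsilon> N \<longleftrightarrow> (\<exists>G\<subseteq>H. finite G \<and> real (card G) \<le> N \<and>
     (\<forall>t\<in>H. \<exists>u\<in>G. \<forall>i\<in>I. \<bar>a t i - a u i\<bar> \<le> \<epsilon>))"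

text \<open>The usual way to get a net: finitely many labels, one representative for each.\<close>

lemma has_net_of_labels:
  assumes c: "finite (c ` H)" "real (card (c ` H)) \<le> N"
    and close: "\<And>t u i. t \<in> H \<Longrightarrow> u \<in> H \<Longrightarrow> c t = c u \<Longrightarrow> i \<in> I \<Longrightarrow> \<bar>a t i - a u i\<bar> \<le> \<epsilon>"
  shows "has_net H a I \<epsilon> N"
proof -
  let ?G = "inv_into H c ` c ` H"
  have "real (card ?G) \<le> N"
    using card_image_le[OF c(1), of "inv_into H c"] c(2) by linarith
  moreover have "\<exists>u\<in>?G. \<forall>i\<in>I. \<bar>a t i - a u i\<bar> \<le> \<epsilon>" if "t \<in> H" for t
    using close[of t "inv_into H c (c t)"] that
    by (intro bexI[of _ "inv_into H c (c t)"]) (auto simp: inv_into_into f_inv_into_f)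
  ultimately show ?thesis
    unfolding has_net_def using c(1) by (intro exI[of _ ?G]) (auto simp: inv_into_into)
qed

lemma has_net_square:
  assumes net: "has_net H a I \<epsilon> N" and bd: "\<And>t i. t \<in> H \<Longrightarrow> i \<in> I \<Longrightarrow> \<bar>a t i\<bar> \<le> 1"
  shows "has_net H (\<lambda>t i. (a t i)\<^sup>2) I (2 * \<epsilon>) N"
proof -
  have "\<bar>x\<^sup>2 - y\<^sup>2\<bar> \<le> 2 * \<epsilon>" if "\<bar>x - y\<bar> \<le> \<epsilon>" "\<bar>x\<bar> \<le> 1" "\<bar>y\<bar> \<le> 1" for x y :: real
  proof -
    have "\<bar>x\<^sup>2 - y\<^sup>2\<bar> = \<bar>x + y\<bar> * \<bar>x - y\<bar>"
      by (simp add: power2_eq_square abs_mult[symmetric] algebra_simps)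
    also have "\<dots> \<le> 2 * \<epsilon>" using that by (intro mult_mono) auto
    finally show ?thesis .
  qed
  with net bd show ?thesis unfolding has_net_def by (meson subsetD)
qed

text \<open>Massart's finite class lemma, left in the form with a free parameter \<open>\<kappa>\<close>, which is linear
  in the variance bound \<open>v\<close>. This allows \<open>v\<close> to be random later without a square root to
  take out of an expectation. The exponential of the maximum over the net is at most the sum of the
  exponentials; its logarithm is replaced by the tangent \<open>ln C + z / C - 1\<close> at an upper bound \<open>C\<close>
  of the average of that sum over the signs, so that the average can be taken inside.\<close>

lemma rademacher_sup_bound:
  fixes a :: "'h \<Rightarrow> 'i \<Rightarrow> real" and \<epsilon> :: real
  assumes I: "finite I" and net: "has_net H a I \<epsilon> N" and H: "H \<noteq> {}" and \<kappa>: "0 < \<kappa>"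
    and var: "\<And>t. t \<in> H \<Longrightarrow> (\<Sum>i\<in>I. (a t i)\<^sup>2) \<le> v"
  shows "(\<Sum>S\<in>Pow I. SUP t\<in>H. ennreal \<bar>\<Sum>i\<in>I. rademacher S i * a t i\<bar>)
    \<le> ennreal (2 ^ card I * (real (card I) * \<epsilon> + ln (2 * N) / \<kappa> + \<kappa> * v / 2))"
proof -
  obtain G where G: "G \<subseteq> H" "finite G" "real (card G) \<le> N"
    and near: "\<And>t. t \<in> H \<Longrightarrow> \<exists>u\<in>G. \<forall>i\<in>I. \<bar>a t i - a u i\<bar> \<le> \<epsilon>"
    using net by (auto simp: has_net_def)
  have N1: "1 \<le> N"
  proof -
    have "G \<noteq> {}" using near H by blast
    then have "0 < card G" using G(2) by (simp add: card_gt_0_iff)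
    then show ?thesis using G(3) by linarith
  qed
  define z where "z S t = (\<Sum>i\<in>I. rademacher S i * a t i)" for S t
  define E where "E S = (\<Sum>u\<in>G. exp (\<kappa> * z S u) + exp (- \<kappa> * z S u))" for S
  \<comment> \<open>The average over all signs of \<open>E S\<close> is at most \<open>C\<close>.\<close>
  define C where "C = 2 * N * exp (\<kappa>\<^sup>2 * v / 2)"
  have C: "0 < C" using N1 by (simp add: C_def)
  define B where "B S = real (card I) * \<epsilon> + (ln C + E S / C - 1) / \<kappa>" for S
  have zB: "\<bar>z S t\<bar> \<le> B S" if t: "t \<in> H" for S t
  proof -
    obtain u where u: "u \<in> G" "\<And>i. i \<in> I \<Longrightarrow> \<bar>a t i - a u i\<bar> \<le> \<epsilon>" using near[OF t] by blast
    have "\<bar>z S t - z S u\<bar> \<le> (\<Sum>i\<in>I. \<bar>a t i - a u i\<bar>)"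
      unfolding z_def sum_subtractf[symmetric]
      by (rule order_trans[OF sum_abs])
        (auto intro!: sum_mono simp: rademacher_def abs_minus_commute)
    also have "\<dots> \<le> real (card I) * \<epsilon>"
      using u(2) by (intro sum_bounded_above) auto
    finally have 1: "\<bar>z S t\<bar> \<le> real (card I) * \<epsilon> + \<bar>z S u\<bar>" by linarith
    have "exp (\<kappa> * \<bar>z S u\<bar>) \<le> exp (\<kappa> * z S u) + exp (- \<kappa> * z S u)"
      by (cases "0 \<le> z S u") (auto simp: less_imp_le)
    also have "\<dots> \<le> E S"
      unfolding E_def using u(1) G(2) by (intro member_le_sum) (auto intro!: add_nonneg_nonneg)
    finally have "exp (\<kappa> * \<bar>z S u\<bar>) / C \<le> E S / C" using C by (simp add: divide_right_mono)
    moreover have "\<kappa> * \<bar>z S u\<bar> - ln C = ln (exp (\<kappa> * \<bar>z S u\<bar>) / C)"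
      using C by (simp add: ln_div)
    moreover have "\<dots> \<le> exp (\<kappa> * \<bar>z S u\<bar>) / C - 1"
      using C by (intro ln_le_minus_one) auto
    ultimately have "\<kappa> * \<bar>z S u\<bar> \<le> ln C + E S / C - 1" by linarith
    then have "\<bar>z S u\<bar> \<le> (ln C + E S / C - 1) / \<kappa>"
      using \<kappa> by (simp add: pos_le_divide_eq mult.commute)
    with 1 show ?thesis by (simp add: B_def)
  qed
  have B0: "0 \<le> B S" for S
    using H zB[of _ S] abs_ge_zero order_trans by blast
  have E: "(\<Sum>S\<in>Pow I. E S) \<le> 2 ^ card I * C"
  proof -
    have half: "(\<Sum>S\<in>Pow I. exp (s * z S u)) \<le> 2 ^ card I * exp (\<kappa>\<^sup>2 * v / 2)"
      if "u \<in> H" and s: "s\<^sup>2 = \<kappa>\<^sup>2" for u s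
    proof -
      have "(\<Sum>S\<in>Pow I. exp (s * z S u)) = (\<Sum>S\<in>Pow I. exp (\<Sum>i\<in>I. rademacher S i * (s * a u i)))"
        by (simp add: z_def sum_distrib_left mult.left_commute)
      also have "\<dots> \<le> 2 ^ card I * exp ((\<Sum>i\<in>I. (s * a u i)\<^sup>2) / 2)"
        by (rule rademacher_exp_moment[OF I])
      also have "(\<Sum>i\<in>I. (s * a u i)\<^sup>2) = \<kappa>\<^sup>2 * (\<Sum>i\<in>I. (a u i)\<^sup>2)"
        by (simp add: power_mult_distrib sum_distrib_left s)
      finally show ?thesis
        using mult_left_mono[OF var[OF \<open>u \<in> H\<close>], of "\<kappa>\<^sup>2"]
        by (elim order_trans) auto
    qed
    have "(\<Sum>S\<in>Pow I. E S) = (\<Sum>u\<in>G. (\<Sum>S\<in>Pow I. exp (\<kappa> * z S u)) + (\<Sum>S\<in>Pow I. exp (- \<kappa> * z S u)))"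
      unfolding E_def by (subst sum.swap) (simp add: sum.distrib)
    also have "\<dots> \<le> (\<Sum>u\<in>G. 2 * (2 ^ card I * exp (\<kappa>\<^sup>2 * v / 2)))"
    proof (rule sum_mono)
      fix u assume "u \<in> G"
      then show "(\<Sum>S\<in>Pow I. exp (\<kappa> * z S u)) + (\<Sum>S\<in>Pow I. exp (- \<kappa> * z S u))
          \<le> 2 * (2 ^ card I * exp (\<kappa>\<^sup>2 * v / 2))"
        using half[of u \<kappa>] half[of u "- \<kappa>"] G(1) by auto
    qed
    also have "\<dots> = card G * (2 * (2 ^ card I * exp (\<kappa>\<^sup>2 * v / 2)))" by simp
    also have "\<dots> \<le> N * (2 * (2 ^ card I * exp (\<kappa>\<^sup>2 * v / 2)))"
      using G(3) by (intro mult_right_mono) auto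
    finally show ?thesis by (simp add: C_def algebra_simps)
  qed
  have "(\<Sum>S\<in>Pow I. SUP t\<in>H. ennreal \<bar>\<Sum>i\<in>I. rademacher S i * a t i\<bar>) \<le> (\<Sum>S\<in>Pow I. ennreal (B S))"
    using zB unfolding z_def by (intro sum_mono SUP_least ennreal_leI) auto
  also have "\<dots> = ennreal (\<Sum>S\<in>Pow I. B S)"
    by (rule sum_ennreal) (rule B0)
  finally have "(\<Sum>S\<in>Pow I. SUP t\<in>H. ennreal \<bar>\<Sum>i\<in>I. rademacher S i * a t i\<bar>)
      \<le> ennreal (\<Sum>S\<in>Pow I. B S)" .
  also have "(\<Sum>S\<in>Pow I. B S)
      = 2 ^ card I * (real (card I) * \<epsilon> + (ln C - 1) / \<kappa>) + (\<Sum>S\<in>Pow I. E S) / C / \<kappa>"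
    using I unfolding B_def by (simp add: sum.distrib sum_divide_distrib add_divide_distrib
        diff_divide_distrib card_Pow algebra_simps sum_subtractf)
  also have "ennreal \<dots> \<le> ennreal (2 ^ card I * (real (card I) * \<epsilon> + (ln C - 1) / \<kappa>) + 2 ^ card I / \<kappa>)"
    using E C \<kappa> by (intro ennreal_leI add_left_mono divide_right_mono) (auto simp: pos_divide_le_eq)
  also have "2 ^ card I * (real (card I) * \<epsilon> + (ln C - 1) / \<kappa>) + 2 ^ card I / \<kappa> = 2 ^ card I * (real (card I) * \<epsilon> + ln C / \<kappa>)"
    by (simp add: diff_divide_distrib algebra_simps)
  also have "ln C = ln (2 * N) + \<kappa>\<^sup>2 * v / 2"
    using N1 by (simp add: C_def ln_mult)
  also have "(ln (2 * N) + \<kappa>\<^sup>2 * v / 2) / \<kappa> = ln (2 * N) / \<kappa> + \<kappa> * v / 2"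
    using \<kappa> by (simp add: field_simps power2_eq_square)
  finally show ?thesis by (simp add: add.assoc)
qed

section \<open>Symmetrization\<close>

lemma measurable_SUP_abs [measurable (raw)]:
  fixes f :: "'h \<Rightarrow> 'a \<Rightarrow> real"
  assumes "countable H" "\<And>t. t \<in> H \<Longrightarrow> f t \<in> borel_measurable M"
  shows "(\<lambda>x. SUP t\<in>H. ennreal \<bar>f t x\<bar>) \<in> borel_measurable M"
  using assms by (intro borel_measurable_SUP) auto

text \<open>Symmetrization of one coordinate, with arbitrary offsets \<open>b\<close> standing for the other coordinates.
  The mean is replaced by an independent copy (Jensen), the two copies are exchangeable, and
  \<open>b + (h x - h y)\<close> is the midpoint of \<open>b + 2 h x\<close> and \<open>b - 2 h y\<close>.\<close>

lemma symmetrization_one: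
  fixes h :: "'h \<Rightarrow> 'a \<Rightarrow> real"
  assumes M: "prob_space M" and H: "countable H"
    and h: "\<And>t. t \<in> H \<Longrightarrow> h t \<in> borel_measurable M"
    and bd: "\<And>t x. t \<in> H \<Longrightarrow> \<bar>h t x\<bar> \<le> 1"
  shows "2 * (\<integral>\<^sup>+x. (SUP t\<in>H. ennreal \<bar>b t + (h t x - (\<integral>y. h t y \<partial>M))\<bar>) \<partial>M)
    \<le> (\<integral>\<^sup>+x. (SUP t\<in>H. ennreal \<bar>b t + 2 * h t x\<bar>) + (SUP t\<in>H. ennreal \<bar>b t - 2 * h t x\<bar>) \<partial>M)"
proof -
  interpret M: prob_space M by fact
  interpret pair_sigma_finite M M ..
  define S where "S x y = (SUP t\<in>H. ennreal \<bar>b t + (h t x - h t y)\<bar>)" for x y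
  define U where "U x = (SUP t\<in>H. ennreal \<bar>b t + 2 * h t x\<bar>)" for x
  define D where "D x = (SUP t\<in>H. ennreal \<bar>b t - 2 * h t x\<bar>)" for x
  have [measurable]: "U \<in> borel_measurable M" "D \<in> borel_measurable M"
    unfolding U_def D_def using h H by (auto intro!: measurable_SUP_abs)
  have [measurable]: "(\<lambda>(x, y). S x y) \<in> borel_measurable (M \<Otimes>\<^sub>M M)"
    unfolding S_def split_beta' using h H
    by (intro measurable_SUP_abs borel_measurable_add borel_measurable_diff
        measurable_compose[OF measurable_fst] measurable_compose[OF measurable_snd]) auto
  have S_swap: "(\<lambda>(x, y). S y x) \<in> borel_measurable (M \<Otimes>\<^sub>M M)"
    unfolding S_def split_beta' using h H
    by (intro measurable_SUP_abs borel_measurable_add borel_measurable_diff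
        measurable_compose[OF measurable_fst] measurable_compose[OF measurable_snd]) auto
  have S_meas: "S x \<in> borel_measurable M" "(\<lambda>y. S y x) \<in> borel_measurable M" for x
    unfolding S_def using h H by (auto intro!: measurable_SUP_abs)
  have S2: "S x y + S y x \<le> inverse 2 * ((U x + D y) + (U y + D x))" for x y
  proof -
    have half: "S x y \<le> inverse 2 * (U x + D y)" for x y
      unfolding S_def
    proof (rule SUP_least)
      fix t assume t: "t \<in> H"
      have "ennreal \<bar>b t + (h t x - h t y)\<bar>
          \<le> ennreal (inverse 2 * (\<bar>b t + 2 * h t x\<bar> + \<bar>b t - 2 * h t y\<bar>))"
        by (rule ennreal_leI) (simp add: abs_if)
      also have "\<dots> = inverse 2 * (ennreal \<bar>b t + 2 * h t x\<bar> + ennreal \<bar>b t - 2 * h t y\<bar>)"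
        by (subst ennreal_mult) (auto simp: inverse_ennreal[symmetric])
      also have "\<dots> \<le> inverse 2 * (U x + D y)"
        unfolding U_def D_def using t by (intro mult_left_mono add_mono SUP_upper) auto
      finally show "ennreal \<bar>b t + (h t x - h t y)\<bar> \<le> inverse 2 * (U x + D y)" .
    qed
    show ?thesis using add_mono[OF half[of x y] half[of y x]] by (simp add: distrib_left)
  qed
  have "(SUP t\<in>H. ennreal \<bar>b t + (h t x - (\<integral>y. h t y \<partial>M))\<bar>) \<le> (\<integral>\<^sup>+y. S x y \<partial>M)"
    if x: "x \<in> space M" for x
  proof (rule SUP_least)
    fix t assume t: "t \<in> H"
    have [measurable]: "h t \<in> borel_measurable M" by (rule h[OF t])
    have int: "integrable M (h t)"
      using bd[OF t] by (intro M.integrable_const_bound[of _ 1]) auto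
    have "b t + (h t x - (\<integral>y. h t y \<partial>M)) = (\<integral>y. b t + (h t x - h t y) \<partial>M)"
      using int by (simp add: M.prob_space)
    also have "ennreal \<bar>\<dots>\<bar> \<le> (\<integral>\<^sup>+y. ennreal (norm (b t + (h t x - h t y))) \<partial>M)"
      unfolding real_norm_def[symmetric] by (rule integral_norm_bound_ennreal) (use int in auto)
    also have "\<dots> \<le> (\<integral>\<^sup>+y. S x y \<partial>M)"
      unfolding S_def real_norm_def by (intro nn_integral_mono SUP_upper2[OF t]) auto
    finally show "ennreal \<bar>b t + (h t x - (\<integral>y. h t y \<partial>M))\<bar> \<le> (\<integral>\<^sup>+y. S x y \<partial>M)" .
  qed
  then have "(\<integral>\<^sup>+x. (SUP t\<in>H. ennreal \<bar>b t + (h t x - (\<integral>y. h t y \<partial>M))\<bar>) \<partial>M) \<le> (\<integral>\<^sup>+x. \<integral>\<^sup>+y. S x y \<partial>M \<partial>M)"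
    by (rule nn_integral_mono)
  then have "2 * (\<integral>\<^sup>+x. (SUP t\<in>H. ennreal \<bar>b t + (h t x - (\<integral>y. h t y \<partial>M))\<bar>) \<partial>M)
      \<le> (\<integral>\<^sup>+x. \<integral>\<^sup>+y. S x y \<partial>M \<partial>M) + (\<integral>\<^sup>+x. \<integral>\<^sup>+y. S x y \<partial>M \<partial>M)"
    unfolding mult_2 by (intro add_mono)
  also have "\<dots> = (\<integral>\<^sup>+x. \<integral>\<^sup>+y. S x y \<partial>M \<partial>M) + (\<integral>\<^sup>+x. \<integral>\<^sup>+y. S y x \<partial>M \<partial>M)"
    using Fubini'[of S] by simp
  also have "\<dots> = (\<integral>\<^sup>+x. \<integral>\<^sup>+y. S x y + S y x \<partial>M \<partial>M)"
    using S_meas M.borel_measurable_nn_integral[OF S_swap] M.borel_measurable_nn_integral[of S M]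
    by (simp add: nn_integral_add)
  also have "\<dots> \<le> (\<integral>\<^sup>+x. \<integral>\<^sup>+y. inverse 2 * ((U x + D y) + (U y + D x)) \<partial>M \<partial>M)"
    by (intro nn_integral_mono S2)
  also have "\<dots> = inverse 2 * (2 * (\<integral>\<^sup>+x. U x + D x \<partial>M))"
    by (simp add: nn_integral_cmult nn_integral_multc nn_integral_add M.emeasure_space_1 mult_2 ring_distribs ac_simps)
  also have "\<dots> = (\<integral>\<^sup>+x. U x + D x \<partial>M)"
  proof -
    have "inverse 2 * 2 = (2 / 2 :: ennreal)" by (simp only: divide_ennreal_def mult.commute)
    then show ?thesis by (simp add: mult.assoc[symmetric] ennreal_divide_self)
  qed
  finally show ?thesis by (simp add: U_def D_def)
qed

text \<open>Symmetrization by induction on the coordinates: the centred coordinates are traded for signed ones one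
  at a time. The offsets \<open>b\<close> have to be general because they collect the coordinates
  treated before.\<close>

lemma (in product_prob_space) symmetrization:
  fixes h :: "'h \<Rightarrow> 'a \<Rightarrow> real"
  assumes H: "countable H" and "finite J"
    and h: "\<And>t i. t \<in> H \<Longrightarrow> h t \<in> borel_measurable (M i)"
    and bd: "\<And>t x. t \<in> H \<Longrightarrow> \<bar>h t x\<bar> \<le> 1"
  shows "2 ^ card J * (\<integral>\<^sup>+X. (SUP t\<in>H. ennreal \<bar>b t + (\<Sum>i\<in>J. h t (X i) - (\<integral>x. h t x \<partial>M i))\<bar>) \<partial>PiM J M)
    \<le> (\<Sum>S\<in>Pow J. \<integral>\<^sup>+X. (SUP t\<in>H. ennreal \<bar>b t + 2 * (\<Sum>i\<in>J. rademacher S i * h t (X i))\<bar>) \<partial>PiM J M)"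
  using \<open>finite J\<close>
proof (induction J arbitrary: b)
  case empty
  then show ?case by (simp add: nn_integral_empty)
next
  case (insert i J)
  interpret J: finite_product_prob_space M J by standard (rule insert)
  interpret iJ: pair_sigma_finite "M i" "PiM J M" ..
  define e where "e t j = (\<integral>x. h t x \<partial>M j)" for t j
  define D where "D t X = (\<Sum>j\<in>J. h t (X j) - e t j)" for t X
  define Z where "Z S t X = (\<Sum>j\<in>J. rademacher S j * h t (X j))" for S t X
  have comp: "(\<lambda>X. h t (X j)) \<in> borel_measurable (PiM L M)" if "t \<in> H" "j \<in> L" for t j L
    by (rule measurable_compose[OF measurable_component_singleton[OF that(2)] h[OF that(1)]])
  have D: "D t \<in> borel_measurable (PiM J M)" and Z: "Z S t \<in> borel_measurable (PiM J M)"
    if "t \<in> H" for t S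
    unfolding D_def Z_def using comp[OF that, of _ J]
    by (auto intro!: borel_measurable_sum borel_measurable_diff borel_measurable_times)
  have pair: "(\<lambda>(y, X). SUP t\<in>H. ennreal \<bar>b t + (c * (h t y - d t) + f t X)\<bar>) \<in> borel_measurable (M i \<Otimes>\<^sub>M PiM J M)"
    if "\<And>t. t \<in> H \<Longrightarrow> f t \<in> borel_measurable (PiM J M)" for f c d
    unfolding split_beta' using H h that
    by (intro measurable_SUP_abs borel_measurable_add borel_measurable_times borel_measurable_diff
        measurable_compose[OF measurable_fst] measurable_compose[OF measurable_snd]) auto
  have upd: "(\<Sum>j\<in>J. f j ((X(i := y)) j)) = (\<Sum>j\<in>J. f j (X j))" for X y and f :: "'i \<Rightarrow> 'a \<Rightarrow> real"
    using insert(2) by (intro sum.cong) auto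
  have "2 ^ card (insert i J) * (\<integral>\<^sup>+X. (SUP t\<in>H. ennreal \<bar>b t + (\<Sum>j\<in>insert i J. h t (X j) - e t j)\<bar>) \<partial>PiM (insert i J) M)
      = 2 * (2 ^ card J * (\<integral>\<^sup>+y. \<integral>\<^sup>+X. (SUP t\<in>H. ennreal \<bar>b t + (1 * (h t y - e t i) + D t X)\<bar>) \<partial>PiM J M \<partial>M i))"
    unfolding D_def using H comp insert(1,2) upd[of "\<lambda>j x. h _ x - e _ j"]
    by (subst product_nn_integral_insert_rev[OF insert(1,2)])
      (auto intro!: measurable_SUP_abs borel_measurable_add borel_measurable_sum borel_measurable_diff simp: mult.assoc)
  also have "2 ^ card J * (\<integral>\<^sup>+y. \<integral>\<^sup>+X. (SUP t\<in>H. ennreal \<bar>b t + (1 * (h t y - e t i) + D t X)\<bar>) \<partial>PiM J M \<partial>M i)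
      = (\<integral>\<^sup>+y. 2 ^ card J * (\<integral>\<^sup>+X. (SUP t\<in>H. ennreal \<bar>b t + (1 * (h t y - e t i) + D t X)\<bar>) \<partial>PiM J M) \<partial>M i)"
    by (rule nn_integral_cmult[symmetric]) (rule J.borel_measurable_nn_integral[OF pair[OF D]])
  also have "\<dots> \<le> (\<integral>\<^sup>+y. (\<Sum>S\<in>Pow J. \<integral>\<^sup>+X. (SUP t\<in>H. ennreal \<bar>b t + (1 * (h t y - e t i) + 2 * Z S t X)\<bar>) \<partial>PiM J M) \<partial>M i)"
  proof (rule nn_integral_mono)
    fix y
    show "2 ^ card J * (\<integral>\<^sup>+X. (SUP t\<in>H. ennreal \<bar>b t + (1 * (h t y - e t i) + D t X)\<bar>) \<partial>PiM J M)
        \<le> (\<Sum>S\<in>Pow J. \<integral>\<^sup>+X. (SUP t\<in>H. ennreal \<bar>b t + (1 * (h t y - e t i) + 2 * Z S t X)\<bar>) \<partial>PiM J M)"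
      using insert.IH[of "\<lambda>t. b t + (h t y - e t i)"] by (simp add: D_def Z_def e_def add.assoc)
  qed
  also have "\<dots> = (\<Sum>S\<in>Pow J. \<integral>\<^sup>+y. \<integral>\<^sup>+X. (SUP t\<in>H. ennreal \<bar>b t + (1 * (h t y - e t i) + 2 * Z S t X)\<bar>) \<partial>PiM J M \<partial>M i)"
    by (intro nn_integral_sum J.borel_measurable_nn_integral pair borel_measurable_times) (auto intro: Z)
  also have "\<dots> = (\<Sum>S\<in>Pow J. \<integral>\<^sup>+X. \<integral>\<^sup>+y. (SUP t\<in>H. ennreal \<bar>b t + (1 * (h t y - e t i) + 2 * Z S t X)\<bar>) \<partial>M i \<partial>PiM J M)"
    by (intro sum.cong refl iJ.Fubini'[symmetric] pair borel_measurable_times) (auto intro: Z)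
  also have "2 * \<dots> = (\<Sum>S\<in>Pow J. \<integral>\<^sup>+X. 2 * (\<integral>\<^sup>+y. (SUP t\<in>H. ennreal \<bar>b t + (1 * (h t y - e t i) + 2 * Z S t X)\<bar>) \<partial>M i) \<partial>PiM J M)"
  proof (subst sum_distrib_left, rule sum.cong[OF refl], rule nn_integral_cmult[symmetric])
    fix S
    have "(\<lambda>(X, y). SUP t\<in>H. ennreal \<bar>b t + (1 * (h t y - e t i) + 2 * Z S t X)\<bar>) \<in> borel_measurable (PiM J M \<Otimes>\<^sub>M M i)"
      using pair[of "\<lambda>t X. 2 * Z S t X" 1 "\<lambda>t. e t i"] Z by (subst measurable_pair_swap_iff) (auto simp: split_beta')
    then show "(\<lambda>X. \<integral>\<^sup>+y. (SUP t\<in>H. ennreal \<bar>b t + (1 * (h t y - e t i) + 2 * Z S t X)\<bar>) \<partial>M i) \<in> borel_measurable (PiM J M)"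
      by (rule sigma_finite_measure.borel_measurable_nn_integral[OF sigma_finite_measures])
  qed
  also have "\<dots> \<le> (\<Sum>S\<in>Pow J. \<integral>\<^sup>+X. (\<integral>\<^sup>+y. (SUP t\<in>H. ennreal \<bar>(b t + 2 * Z S t X) + 2 * h t y\<bar>)
      + (SUP t\<in>H. ennreal \<bar>(b t + 2 * Z S t X) - 2 * h t y\<bar>) \<partial>M i) \<partial>PiM J M)"
  proof (intro sum_mono nn_integral_mono)
    fix S X
    show "2 * (\<integral>\<^sup>+y. (SUP t\<in>H. ennreal \<bar>b t + (1 * (h t y - e t i) + 2 * Z S t X)\<bar>) \<partial>M i)
        \<le> (\<integral>\<^sup>+y. (SUP t\<in>H. ennreal \<bar>(b t + 2 * Z S t X) + 2 * h t y\<bar>)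
          + (SUP t\<in>H. ennreal \<bar>(b t + 2 * Z S t X) - 2 * h t y\<bar>) \<partial>M i)"
      using symmetrization_one[OF M.prob_space_axioms[of i] H, where h = h and b = "\<lambda>t. b t + 2 * Z S t X"] h bd
      by (simp add: e_def add.assoc add.commute[of "2 * Z S _ X"])
  qed
  also have "\<dots> = (\<Sum>S\<in>Pow J. (\<integral>\<^sup>+X. (SUP t\<in>H. ennreal \<bar>b t + 2 * (\<Sum>j\<in>insert i J. rademacher S j * h t (X j))\<bar>) \<partial>PiM (insert i J) M)
     + (\<integral>\<^sup>+X. (SUP t\<in>H. ennreal \<bar>b t + 2 * (\<Sum>j\<in>insert i J. rademacher (insert i S) j * h t (X j))\<bar>) \<partial>PiM (insert i J) M))"
  proof (rule sum.cong[OF refl])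
    fix S assume "S \<in> Pow J"
    then have S: "S \<subseteq> J" by simp
    have meas: "(\<lambda>X. SUP t\<in>H. ennreal \<bar>b t + 2 * (\<Sum>j\<in>insert i J. rademacher T j * h t (X j))\<bar>) \<in> borel_measurable (PiM (insert i J) M)" for T
      using H comp[of _ _ "insert i J"]
      by (intro measurable_SUP_abs borel_measurable_add borel_measurable_times borel_measurable_sum) auto
    have split: "(\<integral>\<^sup>+X. (SUP t\<in>H. ennreal \<bar>b t + 2 * (\<Sum>j\<in>insert i J. rademacher T j * h t (X j))\<bar>) \<partial>PiM (insert i J) M)
        = (\<integral>\<^sup>+X. \<integral>\<^sup>+y. (SUP t\<in>H. ennreal \<bar>(b t + 2 * Z S t X) + 2 * (rademacher T i * h t y)\<bar>) \<partial>M i \<partial>PiM J M)"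
      if T: "T - {i} = S" for T
    proof (subst product_nn_integral_insert[OF insert(1,2) meas], intro nn_integral_cong SUP_cong refl)
      fix X y t
      have "(\<Sum>j\<in>J. rademacher T j * h t ((X(i := y)) j)) = Z S t X"
        unfolding Z_def using insert(2) T by (intro sum.cong) (auto simp: rademacher_def)
      then show "ennreal \<bar>b t + 2 * (\<Sum>j\<in>insert i J. rademacher T j * h t ((X(i := y)) j))\<bar>
          = ennreal \<bar>(b t + 2 * Z S t X) + 2 * (rademacher T i * h t y)\<bar>"
        using insert(1,2) by (simp add: algebra_simps)
    qed
    have 1: "(\<lambda>y. SUP t\<in>H. ennreal \<bar>(b t + 2 * Z S t X) + 2 * (c * h t y)\<bar>) \<in> borel_measurable (M i)" for X c
      using H h by (intro measurable_SUP_abs borel_measurable_add borel_measurable_times) auto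
    have 2: "(\<lambda>X. \<integral>\<^sup>+y. (SUP t\<in>H. ennreal \<bar>(b t + 2 * Z S t X) + 2 * (c * h t y)\<bar>) \<partial>M i) \<in> borel_measurable (PiM J M)" for c
    proof (rule sigma_finite_measure.borel_measurable_nn_integral[OF sigma_finite_measures])
      show "(\<lambda>(X, y). SUP t\<in>H. ennreal \<bar>(b t + 2 * Z S t X) + 2 * (c * h t y)\<bar>) \<in> borel_measurable (PiM J M \<Otimes>\<^sub>M M i)"
        unfolding split_beta' using H h Z
        by (intro measurable_SUP_abs borel_measurable_add borel_measurable_times
            measurable_compose[OF measurable_fst] measurable_compose[OF measurable_snd]) auto
    qed
    have "i \<notin> S" using S insert(2) by auto
    then show "(\<integral>\<^sup>+X. (\<integral>\<^sup>+y. (SUP t\<in>H. ennreal \<bar>(b t + 2 * Z S t X) + 2 * h t y\<bar>)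
          + (SUP t\<in>H. ennreal \<bar>(b t + 2 * Z S t X) - 2 * h t y\<bar>) \<partial>M i) \<partial>PiM J M)
        = (\<integral>\<^sup>+X. (SUP t\<in>H. ennreal \<bar>b t + 2 * (\<Sum>j\<in>insert i J. rademacher S j * h t (X j))\<bar>) \<partial>PiM (insert i J) M)
        + (\<integral>\<^sup>+X. (SUP t\<in>H. ennreal \<bar>b t + 2 * (\<Sum>j\<in>insert i J. rademacher (insert i S) j * h t (X j))\<bar>) \<partial>PiM (insert i J) M)"
      using 1[of _ 1] 1[of _ "- 1"] 2[of 1] 2[of "- 1"] split[of S] split[of "insert i S"]
      by (simp add: nn_integral_add rademacher_def add.commute)
  qed
  also have "\<dots> = (\<Sum>S\<in>Pow (insert i J). \<integral>\<^sup>+X. (SUP t\<in>H. ennreal \<bar>b t + 2 * (\<Sum>j\<in>insert i J. rademacher S j * h t (X j))\<bar>) \<partial>PiM (insert i J) M)"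
    by (rule sum_Pow_insert[OF insert(1,2), symmetric])
  finally show ?case by (simp add: e_def mult_left_mono)
qed

section \<open>Expected suprema of centred sums\<close>

text \<open>The nets may depend on the sample \<open>X\<close>; only their size enters. The random quantity in place of the
  variance is the largest sum of squares at the sample.\<close>

lemma (in product_prob_space) expected_sup_deviation:
  fixes h :: "'h \<Rightarrow> 'a \<Rightarrow> real" and \<epsilon> :: real
  assumes H: "countable H" "H \<noteq> {}" and J: "finite J"
    and h: "\<And>t i. t \<in> H \<Longrightarrow> h t \<in> borel_measurable (M i)"
    and bd: "\<And>t x. t \<in> H \<Longrightarrow> \<bar>h t x\<bar> \<le> 1"
    and \<kappa>: "0 < \<kappa>" and \<epsilon>: "0 \<le> \<epsilon>" and N: "1 \<le> N"
    and net: "\<And>X. X \<in> space (PiM J M) \<Longrightarrow> has_net H (\<lambda>t i. h t (X i)) J \<epsilon> N"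
  shows "(\<integral>\<^sup>+X. (SUP t\<in>H. ennreal \<bar>\<Sum>i\<in>J. h t (X i) - (\<integral>x. h t x \<partial>M i)\<bar>) \<partial>PiM J M)
    \<le> ennreal (2 * (real (card J) * \<epsilon> + ln (2 * N) / \<kappa>))
      + ennreal \<kappa> * (\<integral>\<^sup>+X. (SUP t\<in>H. ennreal (\<Sum>i\<in>J. (h t (X i))\<^sup>2)) \<partial>PiM J M)"
proof -
  interpret J: finite_product_prob_space M J by standard (rule J)
  define G where "G X = (SUP t\<in>H. ennreal (\<Sum>i\<in>J. (h t (X i))\<^sup>2))" for X
  define R where "R = 2 * (real (card J) * \<epsilon> + ln (2 * N) / \<kappa>)"
  have R: "0 \<le> R" using \<kappa> \<epsilon> N by (simp add: R_def)
  have comp: "(\<lambda>X. h t (X j)) \<in> borel_measurable (PiM J M)" if "t \<in> H" "j \<in> J" for t j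
    by (rule measurable_compose[OF measurable_component_singleton[OF that(2)] h[OF that(1)]])
  have [measurable]: "G \<in> borel_measurable (PiM J M)"
    unfolding G_def using H comp
    by (intro borel_measurable_SUP measurable_compose[OF _ measurable_ennreal] borel_measurable_sum borel_measurable_power) auto
  have sup_meas: "(\<lambda>X. SUP t\<in>H. ennreal \<bar>0 + 2 * (\<Sum>i\<in>J. rademacher S i * h t (X i))\<bar>) \<in> borel_measurable (PiM J M)" for S
    using H comp by (intro measurable_SUP_abs borel_measurable_add borel_measurable_times borel_measurable_sum) auto
  have pointwise: "(\<Sum>S\<in>Pow J. SUP t\<in>H. ennreal \<bar>0 + 2 * (\<Sum>i\<in>J. rademacher S i * h t (X i))\<bar>)
      \<le> 2 ^ card J * (ennreal R + ennreal \<kappa> * G X)" if X: "X \<in> space (PiM J M)" for X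
  proof -
    have "G X \<le> ennreal (real (card J))"
      unfolding G_def
    proof (intro SUP_least ennreal_leI)
      fix t assume "t \<in> H"
      then have "(h t (X i))\<^sup>2 \<le> 1" for i using bd by (simp add: abs_square_le_1)
      then show "(\<Sum>i\<in>J. (h t (X i))\<^sup>2) \<le> real (card J)"
        using sum_mono[of J "\<lambda>i. (h t (X i))\<^sup>2" "\<lambda>_. 1"] by simp
    qed
    then obtain v where v: "G X = ennreal v" "0 \<le> v"
      by (cases "G X") (auto simp: top_unique)
    have var: "(\<Sum>i\<in>J. (h t (X i))\<^sup>2) \<le> v" if "t \<in> H" for t
    proof -
      have "ennreal (\<Sum>i\<in>J. (h t (X i))\<^sup>2) \<le> G X" unfolding G_def using that by (intro SUP_upper)
      then show ?thesis using v by (simp add: ennreal_le_iff)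
    qed
    have double: "ennreal \<bar>0 + 2 * x\<bar> = 2 * ennreal \<bar>x\<bar>" for x
      by (simp add: abs_mult ennreal_mult)
    have "(\<Sum>S\<in>Pow J. SUP t\<in>H. ennreal \<bar>0 + 2 * (\<Sum>i\<in>J. rademacher S i * h t (X i))\<bar>)
        = 2 * (\<Sum>S\<in>Pow J. SUP t\<in>H. ennreal \<bar>\<Sum>i\<in>J. rademacher S i * h t (X i)\<bar>)"
      unfolding double SUP_mult_left_ennreal[symmetric] by (simp only: sum_distrib_left)
    also have "\<dots> \<le> 2 * ennreal (2 ^ card J * (real (card J) * \<epsilon> + ln (2 * N) / \<kappa> + \<kappa> * v / 2))"
      by (intro mult_left_mono rademacher_sup_bound J net X H \<kappa> var) auto
    also have "\<dots> = ennreal (2 ^ card J * (R + \<kappa> * v))"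
      using \<kappa> \<epsilon> N v by (subst ennreal_numeral[symmetric], subst ennreal_mult[symmetric])
        (auto simp: R_def algebra_simps intro!: arg_cong[where f=ennreal])
    also have "\<dots> = 2 ^ card J * (ennreal R + ennreal \<kappa> * G X)"
      using \<kappa> R v by (simp add: ennreal_mult ennreal_plus ennreal_power[symmetric])
    finally show ?thesis .
  qed
  have "2 ^ card J * (\<integral>\<^sup>+X. (SUP t\<in>H. ennreal \<bar>\<Sum>i\<in>J. h t (X i) - (\<integral>x. h t x \<partial>M i)\<bar>) \<partial>PiM J M)
      \<le> (\<Sum>S\<in>Pow J. \<integral>\<^sup>+X. (SUP t\<in>H. ennreal \<bar>0 + 2 * (\<Sum>i\<in>J. rademacher S i * h t (X i))\<bar>) \<partial>PiM J M)"
    using symmetrization[OF H(1) J h bd, where b = "\<lambda>_. 0"] by simp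
  also have "\<dots> = (\<integral>\<^sup>+X. (\<Sum>S\<in>Pow J. SUP t\<in>H. ennreal \<bar>0 + 2 * (\<Sum>i\<in>J. rademacher S i * h t (X i))\<bar>) \<partial>PiM J M)"
    by (rule nn_integral_sum[symmetric]) (rule sup_meas)
  also have "\<dots> \<le> (\<integral>\<^sup>+X. 2 ^ card J * (ennreal R + ennreal \<kappa> * G X) \<partial>PiM J M)"
    by (intro nn_integral_mono pointwise)
  also have "\<dots> = 2 ^ card J * (ennreal R + ennreal \<kappa> * (\<integral>\<^sup>+X. G X \<partial>PiM J M))"
    by (simp add: nn_integral_cmult nn_integral_add J.emeasure_space_1)
  finally show ?thesis
    unfolding G_def R_def by (subst (asm) ennreal_mult_le_mult_iff) (auto simp: power_eq_top_ennreal_iff)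
qed

text \<open>The random sum of squares is replaced by the largest second moment \<open>v\<close>. The squares
  \<open>h\<^sup>2\<close> form a class of the same kind, with nets of the same size at twice the radius, and \<open>h\<^sup>4 \<le> h\<^sup>2\<close>;
  with \<open>\<kappa> = 1/2\<close> the previous lemma bounds the expected supremum \<open>g\<close> of the sums of squares by \<open>v\<close>, terms
  of the order of \<open>ln N\<close>, and \<open>g / 2\<close>, which is then absorbed on the left.\<close>

lemma (in product_prob_space) expected_sup_deviation_variance:
  fixes h :: "'h \<Rightarrow> 'a \<Rightarrow> real" and \<epsilon> :: real
  assumes H: "countable H" "H \<noteq> {}" and J: "finite J"
    and h: "\<And>t i. t \<in> H \<Longrightarrow> h t \<in> borel_measurable (M i)"
    and bd: "\<And>t x. t \<in> H \<Longrightarrow> \<bar>h t x\<bar> \<le> 1"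
    and \<kappa>: "0 < \<kappa>" and \<epsilon>: "0 \<le> \<epsilon>" and N: "1 \<le> N"
    and net: "\<And>X. X \<in> space (PiM J M) \<Longrightarrow> has_net H (\<lambda>t i. h t (X i)) J \<epsilon> N"
    and var: "\<And>t. t \<in> H \<Longrightarrow> (\<Sum>i\<in>J. \<integral>x. (h t x)\<^sup>2 \<partial>M i) \<le> v"
  shows "(\<integral>\<^sup>+X. (SUP t\<in>H. ennreal \<bar>\<Sum>i\<in>J. h t (X i) - (\<integral>x. h t x \<partial>M i)\<bar>) \<partial>PiM J M)
    \<le> ennreal (2 * (real (card J) * \<epsilon> + ln (2 * N) / \<kappa>) + \<kappa> * (2 * v + 8 * (real (card J) * \<epsilon> + ln (2 * N))))"
proof -
  interpret J: finite_product_prob_space M J by standard (rule J)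
  define G where "G X = (SUP t\<in>H. ennreal (\<Sum>i\<in>J. (h t (X i))\<^sup>2))" for X
  define D where "D X = (SUP t\<in>H. ennreal \<bar>\<Sum>i\<in>J. (h t (X i))\<^sup>2 - (\<integral>x. (h t x)\<^sup>2 \<partial>M i)\<bar>)" for X
  define R where "R = real (card J) * \<epsilon> + ln (2 * N)"
  have R: "0 \<le> R" using \<epsilon> N by (simp add: R_def)
  have v0: "0 \<le> v"
  proof -
    obtain t where "t \<in> H" using H by auto
    have "0 \<le> (\<Sum>i\<in>J. \<integral>x. (h t x)\<^sup>2 \<partial>M i)" by (intro sum_nonneg integral_nonneg) auto
    then show ?thesis using var[OF \<open>t \<in> H\<close>] by linarith
  qed
  have sq_le: "(h t x)\<^sup>2 \<le> 1" if "t \<in> H" for t x using bd[OF that] by (simp add: abs_square_le_1)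
  have comp: "(\<lambda>X. h t (X j)) \<in> borel_measurable (PiM J M)" if "t \<in> H" "j \<in> J" for t j
    by (rule measurable_compose[OF measurable_component_singleton[OF that(2)] h[OF that(1)]])
  have [measurable]: "D \<in> borel_measurable (PiM J M)"
    unfolding D_def using H comp
    by (intro measurable_SUP_abs borel_measurable_sum borel_measurable_diff borel_measurable_power) auto
  have "(\<integral>\<^sup>+X. G X \<partial>PiM J M) \<le> (\<integral>\<^sup>+X. ennreal (real (card J)) \<partial>PiM J M)"
  proof (rule nn_integral_mono)
    fix X show "G X \<le> ennreal (real (card J))"
      unfolding G_def using sum_mono[of J "\<lambda>i. (h _ (X i))\<^sup>2" "\<lambda>_. 1"] sq_le
      by (intro SUP_least ennreal_leI) simp
  qed
  then have "(\<integral>\<^sup>+X. G X \<partial>PiM J M) \<le> ennreal (real (card J))" by (simp add: J.emeasure_space_1)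
  then obtain g where g: "(\<integral>\<^sup>+X. G X \<partial>PiM J M) = ennreal g" "0 \<le> g"
    by (cases "\<integral>\<^sup>+X. G X \<partial>PiM J M") (auto simp: top_unique)
  have "(\<integral>\<^sup>+X. D X \<partial>PiM J M) \<le> ennreal (2 * (real (card J) * (2 * \<epsilon>) + ln (2 * N) / (1 / 2)))
      + ennreal (1 / 2) * (\<integral>\<^sup>+X. (SUP t\<in>H. ennreal (\<Sum>i\<in>J. ((h t (X i))\<^sup>2)\<^sup>2)) \<partial>PiM J M)"
    unfolding D_def
  proof (rule expected_sup_deviation[OF H J])
    show "has_net H (\<lambda>t i. (h t (X i))\<^sup>2) J (2 * \<epsilon>) N" if "X \<in> space (PiM J M)" for X
      using net[OF that] by (rule has_net_square) (rule bd)
  qed (use h sq_le \<epsilon> N in auto)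
  also have "\<dots> \<le> ennreal (4 * R) + ennreal (1 / 2) * ennreal g"
  proof (intro add_mono mult_left_mono)
    show "(\<integral>\<^sup>+X. (SUP t\<in>H. ennreal (\<Sum>i\<in>J. ((h t (X i))\<^sup>2)\<^sup>2)) \<partial>PiM J M) \<le> ennreal g"
      unfolding g(1)[symmetric] G_def
    proof (intro nn_integral_mono SUP_mono bexI)
      fix X t assume "t \<in> H"
      then have "((h t x)\<^sup>2)\<^sup>2 \<le> (h t x)\<^sup>2" for x
        using mult_left_mono[OF sq_le, of t "(h t x)\<^sup>2" x] by (simp add: power2_eq_square[of "(h t x)\<^sup>2"])
      then       show "ennreal (\<Sum>i\<in>J. ((h t (X i))\<^sup>2)\<^sup>2) \<le> ennreal (\<Sum>i\<in>J. (h t (X i))\<^sup>2)"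
        by (intro ennreal_leI sum_mono)
    qed
  qed (auto simp: R_def)
  finally have D: "(\<integral>\<^sup>+X. D X \<partial>PiM J M) \<le> ennreal (4 * R + g / 2)"
    using R g(2) by (subst (asm) ennreal_mult[symmetric], simp, simp, subst (asm) ennreal_plus[symmetric]) auto
  have "ennreal g \<le> (\<integral>\<^sup>+X. D X + ennreal v \<partial>PiM J M)"
    unfolding g(1)[symmetric]
  proof (rule nn_integral_mono)
    fix X
    show "G X \<le> D X + ennreal v"
      unfolding G_def
    proof (rule SUP_least)
      fix t assume t: "t \<in> H"
      have "(\<Sum>i\<in>J. (h t (X i))\<^sup>2) \<le> \<bar>\<Sum>i\<in>J. (h t (X i))\<^sup>2 - (\<integral>x. (h t x)\<^sup>2 \<partial>M i)\<bar> + v"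
        using var[OF t] by (simp add: sum_subtractf)
      then have "ennreal (\<Sum>i\<in>J. (h t (X i))\<^sup>2)
          \<le> ennreal (\<bar>\<Sum>i\<in>J. (h t (X i))\<^sup>2 - (\<integral>x. (h t x)\<^sup>2 \<partial>M i)\<bar> + v)"
        by (rule ennreal_leI)
      also have "\<dots> = ennreal \<bar>\<Sum>i\<in>J. (h t (X i))\<^sup>2 - (\<integral>x. (h t x)\<^sup>2 \<partial>M i)\<bar> + ennreal v"
        using v0 by (intro ennreal_plus) auto
      also have "\<dots> \<le> D X + ennreal v"
        unfolding D_def using t by (intro add_right_mono SUP_upper)
      finally show "ennreal (\<Sum>i\<in>J. (h t (X i))\<^sup>2) \<le> D X + ennreal v" .
    qed
  qed
  also have "\<dots> \<le> ennreal (4 * R + g / 2) + ennreal v"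
    using D by (simp add: nn_integral_add J.emeasure_space_1)
  also have "\<dots> = ennreal (4 * R + g / 2 + v)"
    using R g(2) v0 by (intro ennreal_plus[symmetric]) auto
  finally have "g \<le> 4 * R + g / 2 + v"
    using R g(2) v0 by (subst (asm) ennreal_le_iff) auto
  then have g_le: "g \<le> 2 * v + 8 * R" by linarith
  have "(\<integral>\<^sup>+X. (SUP t\<in>H. ennreal \<bar>\<Sum>i\<in>J. h t (X i) - (\<integral>x. h t x \<partial>M i)\<bar>) \<partial>PiM J M)
    \<le> ennreal (2 * (real (card J) * \<epsilon> + ln (2 * N) / \<kappa>)) + ennreal \<kappa> * ennreal g"
    unfolding g(1)[symmetric] G_def by (rule expected_sup_deviation[OF H J h bd \<kappa> \<epsilon> N net])
  also have "\<dots> = ennreal (2 * (real (card J) * \<epsilon> + ln (2 * N) / \<kappa>) + \<kappa> * g)"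
    using \<kappa> \<epsilon> N g(2) by (simp add: ennreal_mult ennreal_plus)
  also have "\<dots> \<le> ennreal (2 * (real (card J) * \<epsilon> + ln (2 * N) / \<kappa>) + \<kappa> * (2 * v + 8 * R))"
    using g_le \<kappa> by (intro ennreal_leI add_left_mono mult_left_mono) auto
  finally show ?thesis by (simp add: R_def)
qed

section \<open>Traces of a class on a finite set\<close>

lemma shattersE:
  assumes "shatters \<C> A" "B \<subseteq> A"
  obtains C where "C \<in> \<C>" "A \<inter> C = B"
  using assms unfolding shatters_def by meson

lemma shatters_subset:
  assumes "shatters \<C> A" "B \<subseteq> A"
  shows "shatters \<C> B"
  unfolding shatters_def
proof (intro allI impI)
  fix B' assume "B' \<subseteq> B"
  then have "B' \<subseteq> A" using assms(2) by (rule order_trans)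
  then obtain C where C: "C \<in> \<C>" "A \<inter> C = B'" by (rule shattersE[OF assms(1)])
  then have "B \<inter> C = B'" using \<open>B' \<subseteq> B\<close> assms(2) by blast
  then show "\<exists>C\<in>\<C>. B \<inter> C = B'" using C(1) by (rule bexI)
qed

text \<open>Pajor's form of the Sauer-Shelah lemma. Splitting \<open>\<A>\<close> according to membership of a point \<open>x\<close>
  gives two families on the remaining points; what both of them shatter is shattered by \<open>\<A>\<close> also after adding
  \<open>x\<close>, so nothing is lost in the inclusion-exclusion count.\<close>

lemma card_le_card_shattered:
  assumes "finite S" "\<A> \<subseteq> Pow S"
  shows "card \<A> \<le> card {B. B \<subseteq> S \<and> shatters \<A> B}"
  using assms
proof (induction S arbitrary: \<A>)
  case empty
  then consider "\<A> = {}" | "\<A> = {{}}" by auto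
  then show ?case
  proof cases
    case 2
    have "{B. B \<subseteq> {} \<and> shatters {{}} B} = {{} :: 'a set}" by (auto simp: shatters_def)
    with 2 show ?thesis by simp
  qed simp
next
  case (insert x S)
  define A0 where "A0 = {A\<in>\<A>. x \<notin> A}"
  define A1 where "A1 = {A. A \<subseteq> S \<and> insert x A \<in> \<A>}"
  define sh where "sh \<B> = {B. B \<subseteq> S \<and> shatters \<B> B}" for \<B> :: "'a set set"
  have shD: "B \<subseteq> S" "shatters \<B> B" if "B \<in> sh \<B>" for B \<B>
    using that by (simp_all add: sh_def)
  have fin: "finite (sh \<B>)" for \<B> unfolding sh_def using insert(1) by auto
  have finA: "finite A0" "finite A1"
    using insert(1,4) finite_subset[of A0 "Pow (insert x S)"] by (auto simp: A0_def A1_def)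
  have inj: "inj_on (insert x) \<B>" if "\<And>B. B \<in> \<B> \<Longrightarrow> B \<subseteq> S" for \<B>
    using that insert(2) by (intro inj_onI) (metis insert_ident subsetD)
  have split: "\<A> = A0 \<union> insert x ` A1"
  proof -
    have "A \<in> insert x ` A1" if "A \<in> \<A>" "x \<in> A" for A
      using that insert(4) by (intro image_eqI[of _ _ "A - {x}"]) (auto simp: A1_def insert_absorb)
    then show ?thesis by (auto simp: A0_def A1_def)
  qed
  have "A0 \<inter> insert x ` A1 = {}" by (auto simp: A0_def)
  then have "card (A0 \<union> insert x ` A1) = card A0 + card (insert x ` A1)"
    by (intro card_Un_disjoint finite_imageI finA)
  also have "card (insert x ` A1) = card A1" by (intro card_image inj) (auto simp: A1_def)
  finally have "card \<A> = card A0 + card A1" unfolding split[symmetric] .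
  also have "\<dots> \<le> card (sh A0) + card (sh A1)"
    unfolding sh_def using insert(4) by (intro add_mono insert.IH) (auto simp: A0_def A1_def)
  also have "\<dots> = card (sh A0 \<union> sh A1) + card (insert x ` (sh A0 \<inter> sh A1))"
  proof -
    have "card (insert x ` (sh A0 \<inter> sh A1)) = card (sh A0 \<inter> sh A1)"
      by (intro card_image inj) (auto simp: sh_def)
    then show ?thesis using card_Un_Int[OF fin fin, of A0 A1] by simp
  qed
  also have "\<dots> = card ((sh A0 \<union> sh A1) \<union> insert x ` (sh A0 \<inter> sh A1))"
  proof (rule card_Un_disjoint[symmetric])
    have "x \<notin> B" if "B \<in> sh A0 \<union> sh A1" for B using that insert(2) by (auto simp: sh_def)
    then show "(sh A0 \<union> sh A1) \<inter> insert x ` (sh A0 \<inter> sh A1) = {}" by blast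
  qed (simp_all add: fin)
  also have "\<dots> \<le> card {B. B \<subseteq> insert x S \<and> shatters \<A> B}"
  proof (rule card_mono)
    show "finite {B. B \<subseteq> insert x S \<and> shatters \<A> B}"
      by (rule finite_subset[of _ "Pow (insert x S)"]) (auto simp only: finite_Pow_iff finite_insert insert(1) Pow_iff)
    have 0: "shatters \<A> B" if B: "B \<in> sh A0" for B
      unfolding shatters_def
    proof (intro allI impI)
      fix B' assume "B' \<subseteq> B"
      then obtain A where "A \<in> A0" "B \<inter> A = B'" using shattersE shD(2)[OF B] by metis
      then show "\<exists>C\<in>\<A>. B \<inter> C = B'" by (intro bexI[of _ A]) (auto simp: A0_def)
    qed
    have 1: "shatters \<A> B" if B: "B \<in> sh A1" for B
      unfolding shatters_def
    proof (intro allI impI)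
      fix B' assume "B' \<subseteq> B"
      then obtain A where A: "A \<in> A1" "B \<inter> A = B'" using shattersE shD(2)[OF B] by metis
      then show "\<exists>C\<in>\<A>. B \<inter> C = B'"
        using shD(1)[OF B] insert(2) by (intro bexI[of _ "insert x A"]) (auto simp: A1_def)
    qed
    have both: "shatters \<A> (insert x B)" if B: "B \<in> sh A0" "B \<in> sh A1" for B
      unfolding shatters_def
    proof (intro allI impI)
      fix B' assume B': "B' \<subseteq> insert x B"
      show "\<exists>C\<in>\<A>. insert x B \<inter> C = B'"
      proof (cases "x \<in> B'")
        case True
        have "B' - {x} \<subseteq> B" using B' by auto
        then obtain A where A: "A \<in> A1" "B \<inter> A = B' - {x}" using shattersE shD(2)[OF B(2)] by metis
        then show ?thesis using True B' by (intro bexI[of _ "insert x A"]) (auto simp: A1_def)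
      next
        case False
        then have "B' \<subseteq> B" using B' by auto
        then obtain A where A: "A \<in> A0" "B \<inter> A = B'" using shattersE shD(2)[OF B(1)] by metis
        then show ?thesis by (intro bexI[of _ A]) (auto simp: A0_def)
      qed
    qed
    show "sh A0 \<union> sh A1 \<union> insert x ` (sh A0 \<inter> sh A1) \<subseteq> {B. B \<subseteq> insert x S \<and> shatters \<A> B}"
    proof
      fix D assume "D \<in> sh A0 \<union> sh A1 \<union> insert x ` (sh A0 \<inter> sh A1)"
      then consider "D \<in> sh A0" | "D \<in> sh A1" | B where "D = insert x B" "B \<in> sh A0" "B \<in> sh A1" by blast
      then have "D \<subseteq> insert x S \<and> shatters \<A> D"
      proof cases
        case 1 then show ?thesis using 0 shD(1) by blast
      next
        case 2 then show ?thesis using \<open>\<And>B. B \<in> sh A1 \<Longrightarrow> shatters \<A> B\<close> shD(1) by blast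
      next
        case 3 then show ?thesis using both shD(1) by blast
      qed
      then show "D \<in> {B. B \<subseteq> insert x S \<and> shatters \<A> B}" by simp
    qed
  qed
  finally show ?case .
qed

lemma sum_Pow_power_card:
  fixes x :: real
  assumes "finite S"
  shows "(\<Sum>B\<in>Pow S. x ^ card B) = (1 + x) ^ card S"
  using assms
proof (induction S)
  case (insert s S)
  have "(\<Sum>B\<in>Pow (insert s S). x ^ card B) = (\<Sum>B\<in>Pow S. (1 + x) * x ^ card B)"
    unfolding sum_Pow_insert[OF insert(1,2)]
  proof (rule sum.cong[OF refl])
    fix B assume "B \<in> Pow S"
    then have "s \<notin> B" "finite B" using insert(1,2) finite_subset by auto
    then show "x ^ card B + x ^ card (insert s B) = (1 + x) * x ^ card B" by (simp add: algebra_simps)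
  qed
  also have "\<dots> = (1 + x) ^ card (insert s S)"
    using insert by (simp add: sum_distrib_left[symmetric])
  finally show ?case .
qed simp

text \<open>The Sauer-Shelah bound in exponential form. By Pajor's lemma it suffices to count subsets
  of \<open>S\<close> with fewer than \<open>V\<close> elements, each of which has weight at least \<open>1\<close> in
  \<open>x ^ (- V) * (\<Sum>B\<subseteq>S. x ^ card B)\<close>. The free parameter \<open>x\<close> makes it possible to multiply the bounds for
  several classes without optimizing over their indices separately.\<close>

lemma card_traces_le:
  fixes x :: real
  assumes S: "finite S" and V: "shatters_none_of_size \<C> V" and x: "0 < x" "x \<le> 1"
  shows "real (card ((\<inter>) S ` \<C>)) \<le> (1 / x) ^ V * (1 + x) ^ card S"
proof -
  define sh where "sh = {B. B \<subseteq> S \<and> shatters ((\<inter>) S ` \<C>) B}"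
  have sh: "sh \<subseteq> Pow S" by (auto simp: sh_def)
  have small: "card B < V" if B: "B \<in> sh" for B
  proof (rule ccontr)
    assume "\<not> card B < V"
    then obtain B0 where B0: "B0 \<subseteq> B" "card B0 = V" "finite B0"
      using obtain_subset_with_card_n[of V B] by (metis not_less)
    have "shatters \<C> B"
      unfolding shatters_def
    proof (intro allI impI)
      fix B' assume "B' \<subseteq> B"
      have BS: "B \<subseteq> S" "shatters ((\<inter>) S ` \<C>) B" using B by (simp_all add: sh_def)
      obtain D where "D \<in> (\<inter>) S ` \<C>" "B \<inter> D = B'"
        by (rule shattersE[OF BS(2) \<open>B' \<subseteq> B\<close>])
      then obtain C where C: "C \<in> \<C>" "B \<inter> (S \<inter> C) = B'" by auto
      have "B \<inter> C = B'" unfolding C(2)[symmetric] using BS(1) by blast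
      then show "\<exists>C\<in>\<C>. B \<inter> C = B'" using C(1) by (rule bexI)
    qed
    then have "shatters \<C> B0" by (rule shatters_subset) (rule B0)
    with B0 V show False unfolding shatters_none_of_size_def by metis
  qed
  have "real (card ((\<inter>) S ` \<C>)) \<le> real (card sh)"
    unfolding sh_def of_nat_le_iff using S by (intro card_le_card_shattered) auto
  also have "\<dots> = (\<Sum>B\<in>sh. 1)" by simp
  also have "\<dots> \<le> (\<Sum>B\<in>sh. (1 / x) ^ V * x ^ card B)"
  proof (rule sum_mono)
    fix B assume "B \<in> sh"
    then have "(1 / x) ^ card B \<le> (1 / x) ^ V"
      using small[of B] x by (intro power_increasing) auto
    then show "1 \<le> (1 / x) ^ V * x ^ card B"
      using x by (simp add: power_one_over field_simps)
  qed
  also have "\<dots> \<le> (\<Sum>B\<in>Pow S. (1 / x) ^ V * x ^ card B)"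
    using sh S x by (intro sum_mono2) auto
  also have "\<dots> = (1 / x) ^ V * (1 + x) ^ card S"
    using sum_Pow_power_card[OF S, of x] by (simp add: sum_distrib_left[symmetric])
  finally show ?thesis .
qed

section \<open>The score function\<close>

text \<open>The summands of the test statistic, as functions of the two densities at one point. In the symmetric form
  \<open>(sqrt a - sqrt b) / (sqrt a + sqrt b)\<close> the convention \<open>a / 0 = \<infinity>\<close> is automatic, and the
  convention that the ratio \<open>0 / 0\<close> is \<open>1\<close>, with score \<open>0\<close>, turns into the value \<open>0\<close> of a division by \<open>0\<close>.\<close>

abbreviation score :: "real \<Rightarrow> real \<Rightarrow> real" where
  "score a b \<equiv> rho_psi (sqrt_ratio a b)"

lemma score_eq:
  assumes "0 \<le> a" "0 \<le> b"
  shows "score a b = (sqrt a - sqrt b) / (sqrt a + sqrt b)"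
proof (cases "b = 0")
  case False
  then have b: "0 < sqrt b" using assms by simp
  then have "sqrt a / sqrt b - 1 = (sqrt a - sqrt b) / sqrt b" "sqrt a / sqrt b + 1 = (sqrt a + sqrt b) / sqrt b"
    by (simp_all add: field_simps)
  with b False assms show ?thesis by (simp add: sqrt_ratio_def rho_psi_def real_sqrt_divide)
qed (use assms in \<open>auto simp: sqrt_ratio_def rho_psi_def\<close>)

lemma abs_rho_psi_le_1: "\<bar>rho_psi x\<bar> \<le> 1"
proof -
  have "\<bar>y - 1\<bar> \<le> y + 1" if "0 \<le> y" for y :: real using that by linarith
  from this[of "enn2real x"] show ?thesis
    by (auto simp: rho_psi_def abs_divide divide_le_eq_1 intro: add_nonneg_pos)
qed

lemma measurable_score [measurable (raw)]:
  assumes [measurable]: "f \<in> borel_measurable M" "g \<in> borel_measurable M"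
  shows "(\<lambda>x. score (f x) (g x)) \<in> borel_measurable M"
  unfolding rho_psi_def sqrt_ratio_def by measurable

text \<open>The score is Lipschitz in the logarithm of the ratio \<open>a / b\<close>, so a relative error \<open>\<epsilon>\<close> in \<open>a\<close> is harmless, as
  is an additive error \<open>s b\<close>. The one-sided hypothesis allows \<open>b = 0\<close>: it then forces \<open>a' = 0\<close> if \<open>a = 0\<close>.\<close>

lemma score_increase_le:
  assumes nn: "0 \<le> a" "0 \<le> a'" "0 \<le> b" "0 \<le> \<epsilon>" "0 \<le> s" and le: "a' \<le> (1 + \<epsilon>) * a + s * b"
  shows "score a' b - score a b \<le> \<epsilon> / 2 + 2 * sqrt s"
proof (cases "b = 0")
  case True
  have "score a' b \<le> score a b"
    using True nn le by (cases "a = 0") (auto simp: score_eq)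
  then show ?thesis using nn by (smt (verit) divide_nonneg_pos real_sqrt_ge_zero)
next
  case False
  define u u' v where "u = sqrt a" and "u' = sqrt a'" and "v = sqrt b"
  have v: "0 < v" and u: "0 \<le> u" "0 \<le> u'" using False nn by (auto simp: u_def u'_def v_def)
  have diff: "score a' b - score a b = 2 * v * (u' - u) / ((u + v) * (u' + v))"
    using u v nn by (simp add: score_eq u_def[symmetric] u'_def[symmetric] v_def[symmetric] field_simps)
  have "u' \<le> sqrt ((1 + \<epsilon>) * a) + sqrt (s * b)"
    unfolding u'_def using le nn
    by (intro order_trans[OF _ sqrt_add_le_add_sqrt]) (auto intro!: real_sqrt_le_mono mult_nonneg_nonneg)
  also have "\<dots> = sqrt (1 + \<epsilon>) * u + sqrt s * v" by (simp add: real_sqrt_mult u_def v_def)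
  also have "sqrt (1 + \<epsilon>) * u \<le> (1 + \<epsilon>) * u"
    using nn u by (intro mult_right_mono real_le_lsqrt) (auto simp: power2_eq_square algebra_simps)
  finally have u': "u' - u \<le> \<epsilon> * u + sqrt s * v" by (simp add: algebra_simps)
  show ?thesis
  proof (cases "u' \<le> u")
    case True
    then have "2 * v * (u' - u) / ((u + v) * (u' + v)) \<le> 0"
      using u v by (intro divide_nonpos_pos mult_nonneg_nonpos mult_pos_pos) auto
    moreover have "0 \<le> sqrt s" using nn by simp
    ultimately show ?thesis unfolding diff using nn by linarith
  next
    case False
    have "2 * v * (u' - u) / ((u + v) * (u' + v)) \<le> 2 * v * (\<epsilon> * u + sqrt s * v) / ((u + v) * (u + v))"
      using u v False u' nn by (intro frac_le mult_left_mono mult_mono mult_pos_pos) auto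
    also have "\<dots> = \<epsilon> * (2 * v * u / (u + v)\<^sup>2) + 2 * sqrt s * (v\<^sup>2 / (u + v)\<^sup>2)"
      by (simp add: power2_eq_square add_divide_distrib algebra_simps)
    also have "\<dots> \<le> \<epsilon> * (1 / 2) + 2 * sqrt s * 1"
    proof (intro add_mono mult_left_mono)
      have "4 * v * u \<le> (u + v)\<^sup>2" using sum_squares_bound[of u v] by (simp add: power2_sum algebra_simps)
      then show "2 * v * u / (u + v)\<^sup>2 \<le> 1 / 2" using u v by (simp add: pos_divide_le_eq)
      show "v\<^sup>2 / (u + v)\<^sup>2 \<le> 1" using u v by (simp add: pos_divide_le_eq power_mono)
    qed (use nn in auto)
    finally show ?thesis unfolding diff by simp
  qed
qed

lemma score_ge_of_large_ratio:
  assumes "0 \<le> b" "0 < U" "U * b < a"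
  shows "1 - 2 / sqrt U \<le> score a b"
proof -
  have a: "0 < a" using assms by (smt (verit) mult_nonneg_nonneg)
  have "sqrt U * sqrt b \<le> sqrt a"
    using assms unfolding real_sqrt_mult[symmetric] by (intro real_sqrt_le_mono) auto
  then have "sqrt b / sqrt a \<le> 1 / sqrt U" using a assms by (simp add: field_simps)
  moreover have "sqrt b / (sqrt a + sqrt b) \<le> sqrt b / sqrt a"
    using a assms by (intro divide_left_mono) (auto intro!: mult_pos_pos add_pos_nonneg)
  moreover have "score a b = 1 - 2 * (sqrt b / (sqrt a + sqrt b))"
  proof -
    have "0 < sqrt a + sqrt b" using a assms by (intro add_pos_nonneg) auto
    then show ?thesis using a assms by (simp add: score_eq field_simps)
  qed
  ultimately show ?thesis by linarith
qed

text \<open>Two mixtures have nearby scores if their weights are close and their components compare in the same way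
  with the thresholds \<open>j s b\<close>, \<open>j \<le> J\<close>, where \<open>s = \<epsilon>\<^sup>2 / 16\<close>. If no component exceeds the last
  threshold, corresponding components differ by at most \<open>s b\<close>, and the weights by a factor
  \<open>1 + \<epsilon>\<close>. If one exceeds it, it does so in both mixtures; its weight is at least \<open>\<delta>\<close>, so the ratio to \<open>b\<close> is above
  \<open>4 / \<epsilon>\<^sup>2\<close> in both cases and both scores lie in \<open>[1 - \<epsilon>, 1]\<close>.\<close>

lemma score_mixture_close:
  fixes w w' a a' :: "'k \<Rightarrow> real"
  assumes I: "finite I" and \<delta>: "0 < \<delta>" and \<epsilon>: "0 < \<epsilon>" and b: "0 \<le> b"
    and w: "\<And>k. k \<in> I \<Longrightarrow> \<delta> \<le> w k" "(\<Sum>k\<in>I. w k) = 1"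
    and w': "\<And>k. k \<in> I \<Longrightarrow> \<delta> \<le> w' k" "(\<Sum>k\<in>I. w' k) = 1"
    and ww: "\<And>k. k \<in> I \<Longrightarrow> \<bar>w k - w' k\<bar> \<le> \<epsilon> * \<delta>"
    and a: "\<And>k. k \<in> I \<Longrightarrow> 0 \<le> a k" and a': "\<And>k. k \<in> I \<Longrightarrow> 0 \<le> a' k"
    and J: "64 / (\<epsilon> ^ 4 * \<delta>) \<le> real J"
    and pat: "\<And>k j. k \<in> I \<Longrightarrow> j \<le> J \<Longrightarrow> real j * (\<epsilon>\<^sup>2 / 16) * b < a k \<longleftrightarrow> real j * (\<epsilon>\<^sup>2 / 16) * b < a' k"
  shows "\<bar>score (\<Sum>k\<in>I. w k * a k) b - score (\<Sum>k\<in>I. w' k * a' k) b\<bar> \<le> \<epsilon>"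
proof -
  define s where "s = \<epsilon>\<^sup>2 / 16"
  have s: "0 < s" "sqrt s = \<epsilon> / 4" using \<epsilon> by (auto simp: s_def real_sqrt_divide)
  have w0: "0 \<le> w k" "0 \<le> w' k" if "k \<in> I" for k using w(1) w'(1) that \<delta> by force+
  \<comment> \<open>A ratio above \<open>U\<close> makes the score at least \<open>1 - 2 / sqrt U = 1 - \<epsilon>\<close>.\<close>
  define U where "U = 4 / \<epsilon>\<^sup>2"
  have U: "0 < U" "2 / sqrt U = \<epsilon>" using \<epsilon> by (auto simp: U_def real_sqrt_divide)
  have top: "1 - \<epsilon> \<le> score (\<Sum>k\<in>I. v k * c k) b"
    if v: "\<And>k. k \<in> I \<Longrightarrow> \<delta> \<le> v k" and c: "\<And>k. k \<in> I \<Longrightarrow> 0 \<le> c k"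
      and k: "k \<in> I" "real J * s * b < c k" for v c :: "'k \<Rightarrow> real" and k
  proof -
    have "U * b \<le> \<delta> * (real J * s * b)"
    proof -
      have "U = \<delta> * (64 / (\<epsilon> ^ 4 * \<delta>)) * s"
        using \<epsilon> \<delta> by (simp add: U_def s_def power4_eq_xxxx power2_eq_square)
      also have "\<dots> \<le> \<delta> * real J * s" using J \<delta> s by (intro mult_right_mono mult_left_mono) auto
      finally show ?thesis using b by (simp add: mult_right_mono mult.assoc[symmetric])
    qed
    also have "\<dots> < \<delta> * c k" using k(2) \<delta> by simp
    also have "\<dots> \<le> v k * c k" using v[OF k(1)] c[OF k(1)] by (rule mult_right_mono)
    also have "\<dots> \<le> (\<Sum>k\<in>I. v k * c k)"
      using I k v c \<delta> by (intro member_le_sum mult_nonneg_nonneg) (force+)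
    finally show ?thesis using score_ge_of_large_ratio[OF b U(1)] U(2) by simp
  qed
  have step: "score (\<Sum>k\<in>I. v' k * c' k) b - score (\<Sum>k\<in>I. v k * c k) b \<le> \<epsilon>"
    if small: "\<And>k. k \<in> I \<Longrightarrow> c k \<le> real J * s * b"
      and v: "\<And>k. k \<in> I \<Longrightarrow> \<delta> \<le> v k" and v': "\<And>k. k \<in> I \<Longrightarrow> 0 \<le> v' k" "(\<Sum>k\<in>I. v' k) = 1"
      and vv: "\<And>k. k \<in> I \<Longrightarrow> v' k \<le> v k + \<epsilon> * \<delta>"
      and c: "\<And>k. k \<in> I \<Longrightarrow> 0 \<le> c k" and c': "\<And>k. k \<in> I \<Longrightarrow> 0 \<le> c' k"
      and same: "\<And>k j. k \<in> I \<Longrightarrow> j \<le> J \<Longrightarrow> real j * s * b < c k \<longleftrightarrow> real j * s * b < c' k"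
    for v v' c c' :: "'k \<Rightarrow> real"
  proof -
    have cc: "c' k \<le> c k + s * b" if k: "k \<in> I" for k
    proof -
      define j where "j = (LEAST j. c k \<le> real j * s * b)"
      have j: "c k \<le> real j * s * b" "j \<le> J"
        unfolding j_def using small[OF k] by (auto intro: LeastI Least_le)
      then have cj: "c' k \<le> real j * s * b" using same[OF k j(2)] by linarith
      show ?thesis
      proof (cases j)
        case 0
        then have "c' k \<le> 0" using cj by simp
        moreover have "0 \<le> s * b" using s(1) b by simp
        ultimately show ?thesis using c[OF k] by linarith
      next
        case (Suc i)
        then have "real i * s * b < c k"
          using not_less_Least[of i "\<lambda>j. c k \<le> real j * s * b"] by (simp add: j_def)
        then show ?thesis using cj Suc by (simp add: algebra_simps)
      qed
    qed
    have "(\<Sum>k\<in>I. v' k * c' k) \<le> (\<Sum>k\<in>I. v' k * (c k + s * b))"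
      using cc v' by (intro sum_mono mult_left_mono) auto
    also have "\<dots> = (\<Sum>k\<in>I. v' k * c k) + s * b"
      using v'(2) by (simp add: distrib_left sum.distrib sum_distrib_right[symmetric])
    also have "\<dots> \<le> (\<Sum>k\<in>I. (1 + \<epsilon>) * v k * c k) + s * b"
    proof (intro add_right_mono sum_mono mult_right_mono)
      fix k assume "k \<in> I"
      then have "\<epsilon> * \<delta> \<le> \<epsilon> * v k" "v' k \<le> v k + \<epsilon> * \<delta>"
        using v vv \<epsilon> by (auto intro: mult_left_mono)
      then show "v' k \<le> (1 + \<epsilon>) * v k" by (simp add: distrib_right)
    qed (use c in auto)
    also have "\<dots> = (1 + \<epsilon>) * (\<Sum>k\<in>I. v k * c k) + s * b" by (simp add: sum_distrib_left mult.assoc)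
    finally have "score (\<Sum>k\<in>I. v' k * c' k) b - score (\<Sum>k\<in>I. v k * c k) b \<le> \<epsilon> / 2 + 2 * sqrt s"
      using c c' v v' \<delta> \<epsilon> s b
      by (intro score_increase_le sum_nonneg mult_nonneg_nonneg) (force+)
    then show ?thesis using s(2) by simp
  qed
  show ?thesis
  proof (cases "\<exists>k\<in>I. real J * s * b < a k")
    case True
    then obtain k where k: "k \<in> I" "real J * s * b < a k" by blast
    then have "real J * s * b < a' k" using pat[of k J] by (simp add: s_def)
    then have "1 - \<epsilon> \<le> score (\<Sum>k\<in>I. w' k * a' k) b"
      using k(1) w'(1) a' by (intro top[where k = k]) auto
    moreover have "1 - \<epsilon> \<le> score (\<Sum>k\<in>I. w k * a k) b"
      using k w(1) a by (intro top[where k = k]) auto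
    ultimately show ?thesis
      using abs_rho_psi_le_1[of "sqrt_ratio (\<Sum>k\<in>I. w k * a k) b"]
        abs_rho_psi_le_1[of "sqrt_ratio (\<Sum>k\<in>I. w' k * a' k) b"] by linarith
  next
    case False
    then have sm: "\<And>k. k \<in> I \<Longrightarrow> a k \<le> real J * s * b" by force
    then have sm': "\<And>k. k \<in> I \<Longrightarrow> a' k \<le> real J * s * b" using pat[of _ J] by (force simp: s_def)
    have "score (\<Sum>k\<in>I. w k * a k) b - score (\<Sum>k\<in>I. w' k * a' k) b \<le> \<epsilon>"
      using sm' w' w w0 ww a a' pat by (intro step) (auto simp: s_def abs_le_iff algebra_simps)
    moreover have "score (\<Sum>k\<in>I. w' k * a' k) b - score (\<Sum>k\<in>I. w k * a k) b \<le> \<epsilon>"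
      using sm w' w w0 ww a a' pat by (intro step) (auto simp: s_def abs_le_iff algebra_simps)
    ultimately show ?thesis by linarith
  qed
qed

section \<open>Nets for the scores of mixtures\<close>

text \<open>The label of \<open>t\<close> consists of the traces of the subgraphs of its components on the finite set \<open>S\<close> of all pairs
  of a sample point and a threshold, and of its weights rounded to multiples of \<open>\<epsilon> \<delta>\<close>.
  The factor \<open>g\<close> is common to all components, so the comparison of \<open>g f\<close> with \<open>j s p\<close> is the comparison of
  \<open>f\<close> with \<open>j s p / g\<close>; for \<open>g = 0\<close> there is nothing to compare.\<close>

lemma mixture_scores_has_net:
  fixes w :: "'h \<Rightarrow> nat \<Rightarrow> real" and f :: "'h \<Rightarrow> nat \<Rightarrow> 'a \<Rightarrow> real" and V :: "nat \<Rightarrow> nat" and R \<delta> :: real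
  assumes K: "1 \<le> K" and \<delta>: "0 < \<delta>" "\<delta> \<le> 1"
    and V: "\<And>k. k \<in> {1..K} \<Longrightarrow> shatters_none_of_size (subgraph \<Omega> ` \<F> k) (V k)" "\<And>k. k \<in> {1..K} \<Longrightarrow> 1 \<le> V k"
    and w: "\<And>t k. t \<in> H \<Longrightarrow> k \<in> {1..K} \<Longrightarrow> \<delta> \<le> w t k \<and> w t k \<le> 1" "\<And>t. t \<in> H \<Longrightarrow> (\<Sum>k=1..K. w t k) = 1"
    and f: "\<And>t k. t \<in> H \<Longrightarrow> k \<in> {1..K} \<Longrightarrow> f t k \<in> \<F> k"
    and f0: "\<And>t k x. t \<in> H \<Longrightarrow> k \<in> {1..K} \<Longrightarrow> x \<in> \<Omega> \<Longrightarrow> 0 \<le> f t k x"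
    and g: "\<And>x. x \<in> \<Omega> \<Longrightarrow> 0 \<le> g x" and p: "\<And>x. x \<in> \<Omega> \<Longrightarrow> 0 \<le> p x"
    and X: "\<And>i. i < n \<Longrightarrow> X i \<in> \<Omega>"
    and R: "1 \<le> R" "real n \<le> real (\<Sum>k=1..K. V k) * R"
  shows "has_net H (\<lambda>t i. score (g (X i) * (\<Sum>k=1..K. w t k * f t k (X i))) (p (X i))) {..<n} (1 / R)
    ((360 * real K * R ^ 6 / \<delta>\<^sup>2) ^ (\<Sum>k=1..K. V k))"
proof -
  define \<epsilon> where "\<epsilon> = 1 / R"
  have \<epsilon>: "0 < \<epsilon>" "\<epsilon> \<le> 1" using R by (auto simp: \<epsilon>_def)
  define W where "W = (\<Sum>k=1..K. V k)"
  have KW: "K \<le> W"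
    using sum_mono[of "{1..K}" "\<lambda>_. 1" V] V(2) by (simp add: W_def)
  define J where "J = nat \<lceil>64 / (\<epsilon> ^ 4 * \<delta>)\<rceil>"
  have J: "64 / (\<epsilon> ^ 4 * \<delta>) \<le> real J" by (simp add: J_def of_nat_ceiling)
  have J1: "real J + 1 \<le> 66 * R ^ 4 / \<delta>"
  proof -
    have "0 \<le> 64 / (\<epsilon> ^ 4 * \<delta>)" using \<epsilon> \<delta> by simp
    then have "real J \<le> 64 / (\<epsilon> ^ 4 * \<delta>) + 1" unfolding J_def by linarith
    also have "64 / (\<epsilon> ^ 4 * \<delta>) = 64 * R ^ 4 / \<delta>" by (simp add: \<epsilon>_def power_one_over field_simps)
    finally have "real J + 1 \<le> 64 * R ^ 4 / \<delta> + 2 * 1" by simp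
    also have "1 * \<delta> \<le> R ^ 4" using \<delta> one_le_power[OF R(1), of 4] by linarith
    then have "1 \<le> R ^ 4 / \<delta>" using \<delta> by (simp add: pos_le_divide_eq)
    then have "64 * R ^ 4 / \<delta> + 2 * 1 \<le> 64 * R ^ 4 / \<delta> + 2 * (R ^ 4 / \<delta>)" by (intro add_left_mono mult_left_mono) auto
    also have "\<dots> = 66 * R ^ 4 / \<delta>" by simp
    finally show ?thesis .
  qed
  define S where "S = (\<lambda>(i, j). (X i, real j * (\<epsilon>\<^sup>2 / 16) * p (X i) / g (X i))) ` ({..<n} \<times> {..J})"
  have finS: "finite S" by (simp add: S_def)
  \<comment> \<open>With this choice \<open>x * card S \<le> W / K\<close>, so the \<open>K\<close> factors \<open>(1 + x) ^ card S\<close> together cost only \<open>exp W\<close>.\<close>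
  define x where "x = \<delta> / (66 * R ^ 5 * K)"
  have RK: "1 \<le> R ^ 5" "1 \<le> R ^ 5 * K"
    using R K one_le_power[OF R(1), of 5] mult_mono[of 1 "R ^ 5" 1 "real K"] by auto
  have x: "0 < x" "x \<le> 1"
  proof -
    have "0 < 66 * R ^ 5 * K" "\<delta> \<le> 66 * R ^ 5 * K" using RK \<delta> by (simp_all add: mult.assoc)
    then show "0 < x" "x \<le> 1" using \<delta> unfolding x_def by (simp_all add: divide_le_eq_1)
  qed
  have cardS: "x * real (card S) \<le> real W / K"
  proof -
    have "real (card S) \<le> real (n * (J + 1))"
      unfolding S_def of_nat_le_iff using card_image_le[of "{..<n} \<times> {..J}"] by (simp add: card_cartesian_product)
    also have "\<dots> = real n * (real J + 1)" by (simp add: algebra_simps)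
    also have "\<dots> \<le> (real W * R) * (66 * R ^ 4 / \<delta>)"
      using R(2) J1 R(1) by (intro mult_mono) (auto simp: W_def)
    finally have "x * real (card S) \<le> x * ((real W * R) * (66 * R ^ 4 / \<delta>))"
      using x by (intro mult_left_mono) auto
    also have "\<dots> = real W / K"
      using R \<delta> K by (simp add: x_def field_simps power_numeral_reduce)
    finally show ?thesis .
  qed
  define bins where "bins = {..nat \<lfloor>R / \<delta>\<rfloor>}"
  define T where "T k = (\<inter>) S ` subgraph \<Omega> ` \<F> k" for k
  have finT: "finite (T k)" for k
    by (rule finite_subset[of _ "Pow S"]) (use finS in \<open>auto simp: T_def\<close>)
  define c where "c t = (\<lambda>k\<in>{1..K}. S \<inter> subgraph \<Omega> (f t k), \<lambda>k\<in>{1..K}. nat \<lfloor>w t k / (\<epsilon> * \<delta>)\<rfloor>)" for t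
  define Z where "Z = PiE {1..K} T \<times> PiE {1..K} (\<lambda>_. bins)"
  have finZ: "finite Z" unfolding Z_def using finT by (intro finite_cartesian_product finite_PiE) (auto simp: bins_def)
  have cZ: "c ` H \<subseteq> Z"
  proof -
    have "nat \<lfloor>w t k / (\<epsilon> * \<delta>)\<rfloor> \<in> bins" if "t \<in> H" "k \<in> {1..K}" for t k
    proof -
      have "w t k / (\<epsilon> * \<delta>) \<le> 1 / (\<epsilon> * \<delta>)" using w(1)[OF that] \<epsilon> \<delta> by (intro divide_right_mono) auto
      then show ?thesis by (simp add: bins_def \<epsilon>_def nat_mono floor_mono)
    qed
    then show ?thesis using f by (auto simp: c_def Z_def T_def)
  qed
  have cardT: "real (card (T k)) \<le> (1 / x) ^ V k * exp (real W / K)" if k: "k \<in> {1..K}" for k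
  proof -
    have "real (card (T k)) \<le> (1 / x) ^ V k * (1 + x) ^ card S"
      unfolding T_def by (rule card_traces_le[OF finS V(1)[OF k] x])
    also have "(1 + x) ^ card S \<le> exp x ^ card S" using x by (intro power_mono) (auto simp: add.commute)
    also have "\<dots> \<le> exp (real W / K)" using cardS by (simp add: exp_of_nat_mult[symmetric] mult.commute)
    finally show ?thesis using x by (simp add: mult_left_mono)
  qed
  have card_bins: "real (card bins) \<le> 2 * R / \<delta>"
  proof -
    have "1 \<le> R / \<delta>" using R \<delta> by (simp add: pos_le_divide_eq)
    then show ?thesis by (simp add: bins_def) linarith
  qed
  have 2: "1 \<le> 2 * R / \<delta>" using R \<delta> by (simp add: pos_le_divide_eq)
  have "real (card (c ` H)) \<le> real (card Z)"
    using card_mono[OF finZ cZ] by simp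
  also have "\<dots> = (\<Prod>k=1..K. real (card (T k))) * real (card bins) ^ K"
    by (simp add: Z_def card_cartesian_product card_PiE)
  also have "\<dots> \<le> (\<Prod>k=1..K. (1 / x) ^ V k * exp (real W / K)) * (2 * R / \<delta>) ^ K"
    using cardT card_bins R \<delta> x by (intro mult_mono prod_mono power_mono prod_nonneg) auto
  also have "(\<Prod>k=1..K. (1 / x) ^ V k * exp (real W / K)) = (1 / x) ^ W * exp (real W)"
    using K by (simp add: prod.distrib power_sum W_def exp_of_nat_mult[symmetric])
  also have "(2 * R / \<delta>) ^ K \<le> (2 * R / \<delta>) ^ W" by (rule power_increasing[OF KW 2])
  also have "exp (real W) = exp 1 ^ W" by (simp add: exp_of_nat_mult[symmetric])
  also have "(1 / x) ^ W * exp 1 ^ W * (2 * R / \<delta>) ^ W = (exp 1 * (132 * real K * R ^ 6 / \<delta>\<^sup>2)) ^ W"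
    unfolding power_mult_distrib[symmetric] using \<delta>
    by (intro arg_cong[where f="\<lambda>y. y ^ W"]) (simp add: x_def field_simps power_numeral_reduce)
  also have "\<dots> \<le> (360 * real K * R ^ 6 / \<delta>\<^sup>2) ^ W"
  proof (intro power_mono)
    have "exp 1 * 132 \<le> (360 :: real)" using exp_le e_less_272 by simp
    then have "(exp 1 * 132) * (real K * R ^ 6 / \<delta>\<^sup>2) \<le> 360 * (real K * R ^ 6 / \<delta>\<^sup>2)"
      using R by (intro mult_right_mono) auto
    then show "exp 1 * (132 * real K * R ^ 6 / \<delta>\<^sup>2) \<le> 360 * real K * R ^ 6 / \<delta>\<^sup>2" by (simp add: mult.assoc)
  qed (use R in auto)
  finally have card_le: "real (card (c ` H)) \<le> (360 * real K * R ^ 6 / \<delta>\<^sup>2) ^ W"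
    using R x \<delta> by (simp add: mult_left_mono)
  show ?thesis
    unfolding W_def[symmetric] \<epsilon>_def[symmetric]
  proof (rule has_net_of_labels[OF finite_subset[OF cZ finZ] card_le])
    fix t u i assume t: "t \<in> H" and u: "u \<in> H" and c: "c t = c u" and i: "i \<in> {..<n}"
    have Xi: "X i \<in> \<Omega>" using X i by simp
    have tr: "S \<inter> subgraph \<Omega> (f t k) = S \<inter> subgraph \<Omega> (f u k)"
      and bin: "nat \<lfloor>w t k / (\<epsilon> * \<delta>)\<rfloor> = nat \<lfloor>w u k / (\<epsilon> * \<delta>)\<rfloor>" if "k \<in> {1..K}" for k
    proof -
      have "fst (c t) k = fst (c u) k" "snd (c t) k = snd (c u) k" using c by simp_all
      then show "S \<inter> subgraph \<Omega> (f t k) = S \<inter> subgraph \<Omega> (f u k)"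
        and "nat \<lfloor>w t k / (\<epsilon> * \<delta>)\<rfloor> = nat \<lfloor>w u k / (\<epsilon> * \<delta>)\<rfloor>"
        using that by (simp_all add: c_def)
    qed
    have *: "g (X i) * (\<Sum>k=1..K. w t k * f t k (X i)) = (\<Sum>k=1..K. w t k * (g (X i) * f t k (X i)))" for t
      by (simp add: sum_distrib_left mult.left_commute)
    show "\<bar>score (g (X i) * (\<Sum>k=1..K. w t k * f t k (X i))) (p (X i))
        - score (g (X i) * (\<Sum>k=1..K. w u k * f u k (X i))) (p (X i))\<bar> \<le> \<epsilon>"
      unfolding *
    proof (rule score_mixture_close[OF _ \<delta>(1) \<epsilon>(1) p[OF Xi] _ w(2)[OF t] _ w(2)[OF u] _ _ _ J])
      fix k assume k: "k \<in> {1..K}"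
      show "\<delta> \<le> w t k" "\<delta> \<le> w u k" using w(1) t u k by auto
      show "0 \<le> g (X i) * f t k (X i)" "0 \<le> g (X i) * f u k (X i)" using g f0 t u k Xi by auto
      have "0 \<le> w t k / (\<epsilon> * \<delta>)" "0 \<le> w u k / (\<epsilon> * \<delta>)"
        using w(1)[OF t k] w(1)[OF u k] \<delta> \<epsilon> by (auto intro!: divide_nonneg_nonneg)
      then have "\<bar>w t k / (\<epsilon> * \<delta>) - w u k / (\<epsilon> * \<delta>)\<bar> \<le> 1" using bin[OF k] by linarith
      then show "\<bar>w t k - w u k\<bar> \<le> \<epsilon> * \<delta>"
        using \<delta> \<epsilon> by (simp add: diff_divide_distrib[symmetric] abs_divide pos_divide_le_eq)
      fix j assume "j \<le> J"
      define y where "y = (X i, real j * (\<epsilon>\<^sup>2 / 16) * p (X i) / g (X i))"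
      have "y \<in> S" using i \<open>j \<le> J\<close> unfolding S_def y_def by force
      then have yy: "y \<in> subgraph \<Omega> (f t k) \<longleftrightarrow> y \<in> subgraph \<Omega> (f u k)" using tr[OF k] by blast
      show "real j * (\<epsilon>\<^sup>2 / 16) * p (X i) < g (X i) * f t k (X i) \<longleftrightarrow> real j * (\<epsilon>\<^sup>2 / 16) * p (X i) < g (X i) * f u k (X i)"
      proof (cases "g (X i) = 0")
        case False
        then have "0 < g (X i)" using g[OF Xi] by simp
        then show ?thesis using yy Xi by (simp add: y_def subgraph_def pos_divide_less_eq ac_simps)
      qed simp
    qed simp
  qed
qed

section \<open>Second moments of scores and the Hellinger distance\<close>

text \<open>The pointwise inequality behind the variance bound, with \<open>t\<close>, \<open>a\<close>, \<open>b\<close> the square roots of the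
  densities of \<open>P\<close>, \<open>Q\<close> and \<open>Pbar\<close>. In terms of the midpoint \<open>m\<close> of \<open>a\<close> and \<open>b\<close> and the score \<open>d\<close>, the
  difference of the two sides is the sum of squares
  \<open>2 (1 - d\<^sup>2) (t - m)\<^sup>2 + d\<^sup>2 (t - 2 m)\<^sup>2\<close>.\<close>

lemma score_square_le:
  fixes a b t :: real
  assumes "0 \<le> a" "0 \<le> b" "0 \<le> t"
  shows "t\<^sup>2 * ((a - b) / (a + b))\<^sup>2 \<le> (t - a)\<^sup>2 + (t - b)\<^sup>2"
proof (cases "a + b = 0")
  case False
  define d where "d = (a - b) / (a + b)"
  define m where "m = (a + b) / 2"
  have m: "0 < m" using False assms by (simp add: m_def)
  have ab: "a = m * (1 + d)" "b = m * (1 - d)" using False by (simp_all add: m_def d_def field_simps)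
  have d: "\<bar>d\<bar> \<le> 1" using assms False by (auto simp: d_def abs_divide divide_le_eq_1)
  then have d2: "d\<^sup>2 \<le> 1" by (simp add: abs_square_le_1)
  have "(t - a)\<^sup>2 + (t - b)\<^sup>2 - t\<^sup>2 * d\<^sup>2 = 2 * (t - m)\<^sup>2 + (2 * m\<^sup>2 - t\<^sup>2) * d\<^sup>2"
    unfolding ab by (simp add: power2_eq_square algebra_simps)
  also have "\<dots> = 2 * (1 - d\<^sup>2) * (t - m)\<^sup>2 + d\<^sup>2 * (t - 2 * m)\<^sup>2"
    by (simp add: power2_eq_square algebra_simps)
  also have "\<dots> \<ge> 0" using d2 by simp
  finally show ?thesis by (simp add: d_def)
qed simp

lemma is_density_RN:
  assumes N: "finite_measure N" and fin: "finite_measure R" and ac: "absolutely_continuous N R" "sets R = sets N"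
  obtains u :: "'a \<Rightarrow> real" where "is_density N R u"
proof -
  interpret N: finite_measure N by fact
  obtain D where D: "D \<in> borel_measurable N" "AE x in N. RN_deriv N R x = ennreal (D x)" "\<And>x. 0 \<le> D x"
    using N.real_RN_deriv[OF fin ac] by metis
  have "density N D = density N (RN_deriv N R)"
    using D by (intro density_cong) auto
  then have "R = density N D" using N.density_RN_deriv[OF ac] by simp
  then show thesis using D that[of D] by (simp add: is_density_def)
qed

lemma absolutely_continuous_add_measure:
  assumes "sets R = sets Q"
  shows "absolutely_continuous (add_measure Q R) Q" "absolutely_continuous (add_measure Q R) R"
  using assms by (auto simp: absolutely_continuous_def null_sets_def emeasure_add_measure)

lemma finite_measure_add_measure:
  assumes "finite_measure Q" "finite_measure R" "sets R = sets Q"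
  shows "finite_measure (add_measure Q R)"
proof (rule finite_measureI)
  have "space R = space Q" using assms(3) by (rule sets_eq_imp_space_eq)
  then show "emeasure (add_measure Q R) (space (add_measure Q R)) \<noteq> \<infinity>"
    using finite_measure.emeasure_finite[OF assms(1), of "space Q"] finite_measure.emeasure_finite[OF assms(2), of "space R"]
      assms(3) by (simp add: emeasure_add_measure)
qed

text \<open>The measure \<open>P\<close> may charge \<open>\<nu>\<close>-null sets, where \<open>p\<close> and \<open>q\<close> are arbitrary. Relative to
  \<open>Pbar + Q + P\<close> all three measures have densities, and those of \<open>Pbar\<close> and \<open>Q\<close> are in the given ratio
  \<open>p : q\<close> wherever \<open>u = d(Pbar + Q)/dN\<close> is positive. This holds at
  every point and not only almost everywhere, so the scores can be compared pointwise.\<close>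

lemma common_dominating_densities:
  fixes p q :: "'a \<Rightarrow> real"
  assumes P: "prob_space P" "sets P = sets \<nu>"
    and Pbar: "prob_space Pbar" "is_density \<nu> Pbar p" and Q: "prob_space Q" "is_density \<nu> Q q"
  obtains N u s where "finite_measure N" "sets N = sets \<nu>" "\<forall>x\<in>space \<nu>. 0 \<le> u x"
    "is_density N P s" "is_density N Pbar (\<lambda>x. u x * (p x / (p x + q x)))" "is_density N Q (\<lambda>x. u x * (q x / (p x + q x)))"
proof -
  have [measurable]: "p \<in> borel_measurable \<nu>" "q \<in> borel_measurable \<nu>"
    and p0: "\<And>x. x \<in> space \<nu> \<Longrightarrow> 0 \<le> p x" and q0: "\<And>x. x \<in> space \<nu> \<Longrightarrow> 0 \<le> q x"
    and Pb: "Pbar = density \<nu> p" and Qd: "Q = density \<nu> q"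
    using Pbar(2) Q(2) by (auto simp: is_density_def)
  define R where "R = add_measure Pbar Q"
  have setsR: "sets R = sets \<nu>" by (simp add: R_def Pb)
  have R: "R = density \<nu> (\<lambda>x. p x + q x)"
  proof (rule measure_eqI)
    fix A assume "A \<in> sets R"
    then have A[measurable]: "A \<in> sets \<nu>" by (simp add: setsR)
    have "emeasure R A = emeasure Pbar A + emeasure Q A"
      unfolding R_def using A by (subst emeasure_add_measure) (auto simp: Pb Qd)
    also have "\<dots> = (\<integral>\<^sup>+x. ennreal (p x) * indicator A x + ennreal (q x) * indicator A x \<partial>\<nu>)"
      by (simp add: Pb Qd emeasure_density nn_integral_add)
    also have "\<dots> = emeasure (density \<nu> (\<lambda>x. p x + q x)) A"
      using p0 q0 by (auto simp: emeasure_density distrib_right intro!: nn_integral_cong)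
    finally show "emeasure R A = emeasure (density \<nu> (\<lambda>x. p x + q x)) A" .
  qed (simp add: setsR)
  have finR: "finite_measure R"
    unfolding R_def using Pbar(1) Q(1)
    by (intro finite_measure_add_measure prob_space.finite_measure) (simp_all add: Pb Qd)
  have finP: "finite_measure P" using P(1) by (rule prob_space.finite_measure)
  define N where "N = add_measure R P"
  have setsN [measurable_cong]: "sets N = sets \<nu>" by (simp add: N_def setsR)
  have spN: "space N = space \<nu>" using setsN by (rule sets_eq_imp_space_eq)
  have finN: "finite_measure N"
    unfolding N_def by (intro finite_measure_add_measure finR finP) (simp add: setsR P(2))
  have ac: "absolutely_continuous N R" "absolutely_continuous N P"
    unfolding N_def by (intro absolutely_continuous_add_measure, simp add: setsR P(2))+
  obtain s where s: "is_density N P s" using is_density_RN[OF finN finP ac(2)] P(2) setsN by auto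
  obtain u where u: "is_density N R u" using is_density_RN[OF finN finR ac(1)] setsR setsN by auto
  then have [measurable]: "u \<in> borel_measurable N" and u0: "\<And>x. x \<in> space \<nu> \<Longrightarrow> 0 \<le> u x" and Ru: "R = density N u"
    by (auto simp: is_density_def spN)
  have dens: "is_density N (density \<nu> f) (\<lambda>x. u x * (f x / (p x + q x)))"
    if [measurable]: "f \<in> borel_measurable \<nu>" and f: "\<And>x. x \<in> space \<nu> \<Longrightarrow> 0 \<le> f x \<and> f x \<le> p x + q x" for f :: "'a \<Rightarrow> real"
  proof -
    have "density N (\<lambda>x. u x * (f x / (p x + q x))) = density N (\<lambda>x. ennreal (u x) * ennreal (f x / (p x + q x)))"
    proof (intro density_cong AE_I2)
      fix x assume "x \<in> space N"
      then show "ennreal (u x * (f x / (p x + q x))) = ennreal (u x) * ennreal (f x / (p x + q x))"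
        using u0 f by (intro ennreal_mult divide_nonneg_nonneg) (force simp: spN)+
    qed auto
    also have "\<dots> = density R (\<lambda>x. ennreal (f x / (p x + q x)))"
      unfolding Ru by (rule density_density_eq[symmetric]) auto
    also have "\<dots> = density \<nu> (\<lambda>x. ennreal (p x + q x) * ennreal (f x / (p x + q x)))"
      unfolding R by (rule density_density_eq) auto
    also have "\<dots> = density \<nu> f"
    proof (intro density_cong AE_I2)
      fix x assume x: "x \<in> space \<nu>"
      have "(p x + q x) * (f x / (p x + q x)) = f x" using f[OF x] by (cases "p x + q x = 0") auto
      then show "ennreal (p x + q x) * ennreal (f x / (p x + q x)) = ennreal (f x)"
        using f[OF x] by (subst ennreal_mult[symmetric]) auto
    qed auto
    finally show ?thesis
      using u0 f p0 q0 by (auto simp: is_density_def spN intro!: add_nonneg_nonneg mult_nonneg_nonneg divide_nonneg_nonneg)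
  qed
  show thesis
  proof (rule that[OF finN setsN _ s])
    show "\<forall>x\<in>space \<nu>. 0 \<le> u x" using u0 by blast
    show "is_density N Pbar (\<lambda>x. u x * (p x / (p x + q x)))" unfolding Pb by (rule dens) (auto simp: p0 q0)
    show "is_density N Q (\<lambda>x. u x * (q x / (p x + q x)))" unfolding Qd by (rule dens) (auto simp: p0 q0)
  qed
qed

lemma integrable_sqrt_diff_square:
  assumes f: "is_density N P f" and g: "is_density N Q g" and fin: "finite_measure P" "finite_measure Q"
  shows "integrable N (\<lambda>x. (sqrt (f x) - sqrt (g x))\<^sup>2)"
proof -
  have int: "integrable N h" if h: "is_density N R h" and R: "finite_measure R" for h R
  proof (rule integrableI_nonneg)
    have "(\<integral>\<^sup>+x. ennreal (h x) \<partial>N) = emeasure R (space N)"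
      using h by (auto simp: is_density_def emeasure_density intro!: nn_integral_cong)
    also have "\<dots> < \<infinity>" using finite_measure.emeasure_finite[OF R] by (simp add: less_top)
    finally show "(\<integral>\<^sup>+x. ennreal (h x) \<partial>N) < \<infinity>" .
  qed (use h in \<open>auto simp: is_density_def\<close>)
  have [measurable]: "f \<in> borel_measurable N" "g \<in> borel_measurable N"
    using f g by (auto simp: is_density_def)
  have "integrable N (\<lambda>x. f x + g x)" using int f g fin by auto
  then show ?thesis
  proof (rule Bochner_Integration.integrable_bound)
    show "AE x in N. norm ((sqrt (f x) - sqrt (g x))\<^sup>2) \<le> norm (f x + g x)"
    proof (rule AE_I2)
      fix x assume "x \<in> space N"
      then have "0 \<le> f x" "0 \<le> g x" using f g by (auto simp: is_density_def)
      moreover from this have "0 \<le> sqrt (f x) * sqrt (g x)" by simp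
      ultimately show "norm ((sqrt (f x) - sqrt (g x))\<^sup>2) \<le> norm (f x + g x)"
        unfolding real_norm_def abs_power2 by (simp only: power2_diff real_sqrt_pow2 abs_of_nonneg add_nonneg_nonneg)
    qed
  qed auto
qed

text \<open>Integrating \<open>score_square_le\<close>. Where \<open>Pbar + Q\<close> has density \<open>0\<close>, the right-hand side of that inequality is
  twice the density of \<open>P\<close>, and \<open>score\<^sup>2 \<le> 1\<close> suffices.\<close>

lemma score_second_moment_le:
  fixes p q :: "'a \<Rightarrow> real"
  assumes P: "prob_space P" "sets P = sets \<nu>"
    and Pbar: "prob_space Pbar" "is_density \<nu> Pbar p" and Q: "prob_space Q" "is_density \<nu> Q q"
  shows "(\<integral>x. (score (q x) (p x))\<^sup>2 \<partial>P) \<le> 2 * (hellinger_sq P Pbar + hellinger_sq P Q)"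
proof -
  obtain N u s where N: "finite_measure N" and setsN[measurable_cong]: "sets N = sets \<nu>"
    and u: "\<forall>x\<in>space \<nu>. 0 \<le> u x"
    and s: "is_density N P s" and a: "is_density N Pbar (\<lambda>x. u x * (p x / (p x + q x)))"
    and b: "is_density N Q (\<lambda>x. u x * (q x / (p x + q x)))"
    by (rule common_dominating_densities[OF assms])
  interpret N: finite_measure N by fact
  note fin = prob_space.finite_measure[OF P(1)] prob_space.finite_measure[OF Pbar(1)] prob_space.finite_measure[OF Q(1)]
  have spN: "space N = space \<nu>" using setsN by (rule sets_eq_imp_space_eq)
  have [measurable]: "p \<in> borel_measurable \<nu>" "q \<in> borel_measurable \<nu>" "s \<in> borel_measurable N"
    and p0: "\<And>x. x \<in> space \<nu> \<Longrightarrow> 0 \<le> p x" and q0: "\<And>x. x \<in> space \<nu> \<Longrightarrow> 0 \<le> q x"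
    and s0: "\<And>x. x \<in> space \<nu> \<Longrightarrow> 0 \<le> s x" and Ps: "P = density N s"
    using Pbar(2) Q(2) s by (auto simp: is_density_def spN)
  define A where "A x = (sqrt (s x) - sqrt (u x * (p x / (p x + q x))))\<^sup>2" for x
  define B where "B x = (sqrt (s x) - sqrt (u x * (q x / (p x + q x))))\<^sup>2" for x
  have int: "integrable N A" "integrable N B"
    unfolding A_def B_def using s a b fin by (auto intro: integrable_sqrt_diff_square)
  have "(\<integral>x. (score (q x) (p x))\<^sup>2 \<partial>P) = (\<integral>x. s x * (score (q x) (p x))\<^sup>2 \<partial>N)"
    unfolding Ps using s0 by (subst integral_density) (auto simp: spN)
  also have "\<dots> \<le> (\<integral>x. A x + B x \<partial>N)"
  proof (rule integral_mono')
    show "integrable N (\<lambda>x. A x + B x)" using int by simp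
    show "0 \<le> A x + B x" for x by (simp add: A_def B_def)
    show "s x * (score (q x) (p x))\<^sup>2 \<le> A x + B x" if "x \<in> space N" for x
    proof -
      have x: "x \<in> space \<nu>" using that by (simp add: spN)
      have s_sq: "s x = (sqrt (s x))\<^sup>2" using s0[OF x] by simp
      show ?thesis
      proof (cases "u x = 0 \<or> p x + q x = 0")
        case True
        have "(score (q x) (p x))\<^sup>2 \<le> 1" using abs_rho_psi_le_1 by (simp add: abs_square_le_1)
        then have "s x * (score (q x) (p x))\<^sup>2 \<le> s x * 1" using s0[OF x] by (rule mult_left_mono)
        also have "\<dots> \<le> A x + B x" using True s0[OF x] by (auto simp: A_def B_def)
        finally show ?thesis .
      next
        case False
        define c where "c = sqrt (u x / (p x + q x))"
        have c: "0 < c" using False bspec[OF u x] p0[OF x] q0[OF x] by (auto simp: c_def)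
        have "sqrt (u x * (p x / (p x + q x))) = c * sqrt (p x)" "sqrt (u x * (q x / (p x + q x))) = c * sqrt (q x)"
          by (simp_all add: c_def real_sqrt_mult real_sqrt_divide)
        moreover have "score (q x) (p x) = (c * sqrt (q x) - c * sqrt (p x)) / (c * sqrt (q x) + c * sqrt (p x))"
          using c p0[OF x] q0[OF x] by (simp add: score_eq distrib_left[symmetric] right_diff_distrib[symmetric])
        ultimately show ?thesis
          using score_square_le[of "c * sqrt (q x)" "c * sqrt (p x)" "sqrt (s x)"] c p0[OF x] q0[OF x] s0[OF x]
          by (simp add: A_def B_def add.commute)
      qed
    qed
  qed
  also have "\<dots> = (\<integral>x. A x \<partial>N) + (\<integral>x. B x \<partial>N)" using int by simp
  also have "\<dots> = 2 * (hellinger_sq P Pbar + hellinger_sq P Q)"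
    using hellinger_sq_density[OF N.sigma_finite_measure_axioms s a fin(1,2)]
      hellinger_sq_density[OF N.sigma_finite_measure_axioms s b fin(1,3)]
    by (simp add: A_def B_def)
  finally show ?thesis .
qed

section \<open>Bounding the rho-dimension\<close>

lemma (in product_prob_space) integral_PiM_sum:
  fixes h :: "'i \<Rightarrow> 'a \<Rightarrow> real"
  assumes J: "finite J" and h: "\<And>i. i \<in> J \<Longrightarrow> h i \<in> borel_measurable (M i)"
    and bd: "\<And>i x. i \<in> J \<Longrightarrow> \<bar>h i x\<bar> \<le> 1"
  shows "(\<integral>X. (\<Sum>i\<in>J. h i (X i)) \<partial>PiM J M) = (\<Sum>i\<in>J. \<integral>x. h i x \<partial>M i)"
proof -
  interpret J: finite_product_prob_space M J by standard (rule J)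
  have meas: "(\<lambda>X. h i (X i)) \<in> borel_measurable (PiM J M)" if "i \<in> J" for i
    by (rule measurable_compose[where N = "M i" and g = "h i", OF measurable_component_singleton[where i = i and I = J and M = M, OF that] h[OF that]])
  have "(\<integral>X. (\<Sum>i\<in>J. h i (X i)) \<partial>PiM J M) = (\<Sum>i\<in>J. \<integral>X. h i (X i) \<partial>PiM J M)"
    using meas bd by (intro Bochner_Integration.integral_sum J.integrable_const_bound[of _ 1]) auto
  also have "\<dots> = (\<Sum>i\<in>J. \<integral>x. h i x \<partial>M i)"
  proof (rule sum.cong[OF refl])
    fix i assume i: "i \<in> J"
    have "(\<integral>x. h i x \<partial>M i) = (\<integral>x. h i x \<partial>distr (PiM J M) (M i) (\<lambda>X. X i))"
      by (subst distr_PiM_component[OF M.prob_space_axioms i]) simp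
    also have "\<dots> = (\<integral>X. h i (X i) \<partial>PiM J M)"
      by (intro integral_distr measurable_component_singleton i h)
    finally show "(\<integral>X. h i (X i) \<partial>PiM J M) = (\<integral>x. h i x \<partial>M i)" ..
  qed
  finally show ?thesis .
qed

text \<open>The general estimate applied to the scores. The densities \<open>q\<close> are first replaced by almost surely equal
  functions \<open>r\<close>, for which nets are available at every sample; countability of \<open>\<Q>\<close> makes the exceptional
  set negligible.\<close>

lemma rho_w_le:
  fixes P :: "nat \<Rightarrow> 'a measure" and q r :: "'a measure \<Rightarrow> 'a \<Rightarrow> real" and \<epsilon> :: real
  assumes n: "1 \<le> n"
    and P: "\<And>i. i < n \<Longrightarrow> prob_space (P i) \<and> sets (P i) = sets \<nu>"
    and Pbar: "prob_space Pbar" "is_density \<nu> Pbar p"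
    and Q: "countable \<Q>" "\<And>Q. Q \<in> \<Q> \<Longrightarrow> prob_space Q \<and> is_density \<nu> Q (q Q)"
    and r: "\<And>Q. Q \<in> \<Q> \<Longrightarrow> r Q \<in> borel_measurable \<nu>"
    and qr: "\<And>Q i. Q \<in> \<Q> \<Longrightarrow> i < n \<Longrightarrow> AE x in P i. q Q x = r Q x"
    and \<kappa>: "0 < \<kappa>" and \<epsilon>: "0 \<le> \<epsilon>" and N: "1 \<le> N"
    and net: "\<And>H X. H \<subseteq> \<Q> \<Longrightarrow> (\<And>i. i < n \<Longrightarrow> X i \<in> space \<nu>) \<Longrightarrow>
      has_net H (\<lambda>Q i. score (r Q (X i)) (p (X i))) {..<n} \<epsilon> N"
  shows "rho_w n P Pbar p \<Q> q y
    \<le> ennreal (2 * (real n * \<epsilon> + ln (2 * N) / \<kappa>) + \<kappa> * (4 * y\<^sup>2 + 8 * (real n * \<epsilon> + ln (2 * N))))"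
proof -
  define H where "H = {Q\<in>\<Q>. prod_hellinger_sq n P (\<lambda>_. Pbar) + prod_hellinger_sq n P (\<lambda>_. Q) < y\<^sup>2}"
  have HQ: "H \<subseteq> \<Q>" by (auto simp: H_def)
  show ?thesis
  proof (cases "H = {}")
    case True
    then show ?thesis unfolding rho_w_def H_def[symmetric] by (simp add: bot_ennreal)
  next
    case False
    \<comment> \<open>Product measures are treated for families of probabilities over all indices, so the family is extended.\<close>
    define M where "M i = (if i < n then P i else P 0)" for i
    have M: "prob_space (M i)" "sets (M i) = sets \<nu>" for i
      using P[of i] P[of 0] n by (auto simp: M_def)
    have spM: "space (M i) = space \<nu>" for i using M(2) by (rule sets_eq_imp_space_eq)
    interpret M: product_prob_space M
      using M(1) by (simp add: product_prob_space_def product_prob_space_axioms_def product_sigma_finite_def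
          prob_space_imp_sigma_finite)
    interpret Mn: finite_product_prob_space M "{..<n}" by standard simp
    have MP: "M i = P i" if "i < n" for i using that by (simp add: M_def)
    have PM: "PiM {..<n} P = PiM {..<n} M" by (rule PiM_cong) (auto simp: M_def)
    have cH: "countable H" using Q(1) HQ countable_subset by blast
    have [measurable]: "p \<in> borel_measurable \<nu>" using Pbar(2) by (simp add: is_density_def)
    define h where "h Q x = score (r Q x) (p x)" for Q x
    have on_M: "f \<in> borel_measurable (M i)" if "f \<in> borel_measurable \<nu>" for f :: "'a \<Rightarrow> real" and i
      using that measurable_cong_sets[OF M(2) refl] by blast
    have h: "h Q \<in> borel_measurable (M i)" if "Q \<in> H" for Q i
      using r[of Q] that HQ unfolding h_def by (intro on_M measurable_score) auto
    have hq: "(\<lambda>x. score (q Q x) (p x)) \<in> borel_measurable (M i)" if "Q \<in> H" for Q i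
      using Q(2)[of Q] that HQ by (intro on_M measurable_score) (auto simp: is_density_def)
    have bd: "\<bar>score a b\<bar> \<le> 1" for a b by (rule abs_rho_psi_le_1)
    have ae: "AE x in M i. q Q x = r Q x" if "Q \<in> H" "i < n" for Q i
      using qr[OF subsetD[OF HQ that(1)] that(2)] unfolding MP[OF that(2)] .
    have ae_all: "AE X in PiM {..<n} M. \<forall>Q\<in>H. \<forall>i\<in>{..<n}. q Q (X i) = r Q (X i)"
      using cH ae by (intro AE_ball_countable[THEN iffD2] ballI AE_PiM_component M(1)) auto
    have mean: "(\<integral>X. rho_T n p (q Q) X \<partial>PiM {..<n} M) = (\<Sum>i<n. \<integral>x. h Q x \<partial>M i)" if Q: "Q \<in> H" for Q
    proof -
      have "(\<integral>X. rho_T n p (q Q) X \<partial>PiM {..<n} M) = (\<Sum>i<n. \<integral>x. score (q Q x) (p x) \<partial>M i)"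
        unfolding rho_T_def using hq[OF Q] bd by (intro M.integral_PiM_sum) auto
      also have "\<dots> = (\<Sum>i<n. \<integral>x. h Q x \<partial>M i)"
      proof (rule sum.cong[OF refl])
        fix i assume "i \<in> {..<n}"
        then show "(\<integral>x. score (q Q x) (p x) \<partial>M i) = (\<integral>x. h Q x \<partial>M i)"
          using ae[OF Q, of i] hq[OF Q] h[OF Q, unfolded h_def] by (intro integral_cong_AE) (auto simp: h_def)
      qed
      finally show ?thesis .
    qed
    have var: "(\<Sum>i<n. \<integral>x. (h Q x)\<^sup>2 \<partial>M i) \<le> 2 * y\<^sup>2" if QH: "Q \<in> H" for Q
    proof -
      have "(\<Sum>i<n. \<integral>x. (h Q x)\<^sup>2 \<partial>M i) \<le> (\<Sum>i<n. 2 * (hellinger_sq (P i) Pbar + hellinger_sq (P i) Q))"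
      proof (rule sum_mono)
        fix i assume "i \<in> {..<n}"
        then have i: "i < n" by simp
        have "(\<integral>x. (h Q x)\<^sup>2 \<partial>M i) = (\<integral>x. (score (q Q x) (p x))\<^sup>2 \<partial>P i)"
          unfolding MP[OF i, symmetric] using ae[OF QH i] hq[OF QH, of i] h[OF QH, of i, unfolded h_def]
          by (intro integral_cong_AE) (auto simp: h_def)
        also have "\<dots> \<le> 2 * (hellinger_sq (P i) Pbar + hellinger_sq (P i) Q)"
          using P[OF i] Pbar Q(2)[of Q] QH HQ by (intro score_second_moment_le) auto
        finally show "(\<integral>x. (h Q x)\<^sup>2 \<partial>M i) \<le> 2 * (hellinger_sq (P i) Pbar + hellinger_sq (P i) Q)" .
      qed
      also have "\<dots> = 2 * (prod_hellinger_sq n P (\<lambda>_. Pbar) + prod_hellinger_sq n P (\<lambda>_. Q))"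
        by (simp add: prod_hellinger_sq_def sum_distrib_left sum.distrib)
      also have "\<dots> \<le> 2 * y\<^sup>2" using QH by (simp add: H_def)
      finally show ?thesis .
    qed
    have "rho_w n P Pbar p \<Q> q y
        = (\<integral>\<^sup>+X. (SUP Q\<in>H. ennreal \<bar>\<Sum>i<n. h Q (X i) - (\<integral>x. h Q x \<partial>M i)\<bar>) \<partial>PiM {..<n} M)"
      unfolding rho_w_def H_def[symmetric] PM
    proof (rule nn_integral_cong_AE)
      show "AE X in PiM {..<n} M. (SUP Q\<in>H. ennreal \<bar>rho_T n p (q Q) X - (\<integral>X'. rho_T n p (q Q) X' \<partial>PiM {..<n} M)\<bar>)
          = (SUP Q\<in>H. ennreal \<bar>\<Sum>i<n. h Q (X i) - (\<integral>x. h Q x \<partial>M i)\<bar>)"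
        using ae_all
      proof eventually_elim
        case (elim X)
        then show ?case
        proof (intro SUP_cong refl)
          fix Q assume Q: "Q \<in> H"
          have "rho_T n p (q Q) X = (\<Sum>i<n. h Q (X i))" using elim Q by (simp add: rho_T_def h_def)
          then show "ennreal \<bar>rho_T n p (q Q) X - (\<integral>X'. rho_T n p (q Q) X' \<partial>PiM {..<n} M)\<bar>
              = ennreal \<bar>\<Sum>i<n. h Q (X i) - (\<integral>x. h Q x \<partial>M i)\<bar>"
            by (simp only: mean[OF Q] sum_subtractf)
        qed
      qed
    qed
    also have "\<dots> \<le> ennreal (2 * (real (card {..<n}) * \<epsilon> + ln (2 * N) / \<kappa>)
        + \<kappa> * (2 * (2 * y\<^sup>2) + 8 * (real (card {..<n}) * \<epsilon> + ln (2 * N))))"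
    proof (rule M.expected_sup_deviation_variance[OF cH False _ h _ \<kappa> \<epsilon> N _ var])
      fix X assume "X \<in> space (PiM {..<n} M)"
      then have "X i \<in> space \<nu>" if "i < n" for i using that by (auto simp: space_PiM spM)
      then show "has_net H (\<lambda>Q i. h Q (X i)) {..<n} \<epsilon> N" unfolding h_def by (rule net[OF HQ])
    qed (auto simp: h_def bd)
    finally show ?thesis by simp
  qed
qed

text \<open>The weights and components outside \<open>{1..K}\<close> are arbitrary but do not influence the mixture.\<close>

lemma countable_mixture_model:
  assumes "\<And>k. k \<in> {1..K} \<Longrightarrow> countable (F k (l k))"
  shows "countable (mixture_model \<mu> F \<delta> (K, l))"
proof (rule countable_subset)
  let ?W = "PiE {1..K} (\<lambda>_. \<rat>) \<times> PiE {1..K} (\<lambda>k. F k (l k))"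
  show "mixture_model \<mu> F \<delta> (K, l) \<subseteq> (\<lambda>(w, G). mixture \<mu> K w G) ` ?W"
  proof
    fix Q assume "Q \<in> mixture_model \<mu> F \<delta> (K, l)"
    then obtain w G where w: "w \<in> rational_weights (\<delta> (K, l)) K" and G: "\<forall>k\<in>{1..K}. G k \<in> F k (l k)"
      and Q: "Q = mixture \<mu> K w G"
      by (auto simp: mixture_model_def)
    have "Q = mixture \<mu> K (restrict w {1..K}) (restrict G {1..K})"
      unfolding Q mixture_def by (intro arg_cong[where f = "measure_of _ _"] ext sum.cong) auto
    then show "Q \<in> (\<lambda>(w, G). mixture \<mu> K w G) ` ?W"
      using w G by (intro image_eqI[of _ _ "(restrict w {1..K}, restrict G {1..K})"])
        (auto simp: rational_weights_def)
  qed
  show "countable ((\<lambda>(w, G). mixture \<mu> K w G) ` ?W)"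
    using assms by (intro countable_image countable_SIGMA countable_PiE) (auto simp: countable_rat)
qed

text \<open>The only term not of the form \<open>W\<close> times a logarithm is the \<open>ln 2\<close> from the two signs of a deviation, and \<open>1 \<le> W\<close>
  absorbs it.\<close>

lemma ln_net_size_le:
  fixes R \<delta> :: real
  assumes K: "1 \<le> K" and W: "1 \<le> W" and R: "1 \<le> R" and \<delta>: "0 < \<delta>" "\<delta> \<le> 1"
  shows "1 \<le> (360 * real K * R ^ 6 / \<delta>\<^sup>2) ^ W"
    and "ln (2 * (360 * real K * R ^ 6 / \<delta>\<^sup>2) ^ W) \<le> 6 * real W * (5.82 + ln ((real K + 1)\<^sup>2 / \<delta>) + ln R)"
proof -
  define N0 where "N0 = 360 * real K * R ^ 6 / \<delta>\<^sup>2"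
  have R6: "1 \<le> R ^ 6" using R by (rule one_le_power)
  have d2: "0 < \<delta>\<^sup>2" "\<delta>\<^sup>2 \<le> 1" using \<delta> by (auto simp: power_le_one)
  have "1 \<le> real K * R ^ 6" using K R6 mult_mono[of 1 "real K" 1 "R ^ 6"] by simp
  then have "\<delta>\<^sup>2 \<le> 360 * real K * R ^ 6" using d2 by (simp add: mult.assoc)
  then have N0: "1 \<le> N0" using d2 by (simp add: N0_def pos_le_divide_eq)
  then show "1 \<le> (360 * real K * R ^ 6 / \<delta>\<^sup>2) ^ W" unfolding N0_def[symmetric] by (rule one_le_power)
  have l2: "0 \<le> ln (2 :: real)" "ln (2 :: real) \<le> 1" using ln_le_minus_one[of "2 :: real"] by auto
  have "ln (2 * N0 ^ W) = ln 2 + real W * ln N0" using N0 by (simp add: ln_mult ln_realpow)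
  also have "\<dots> \<le> real W * ln 2 + real W * ln N0" using W l2 mult_right_mono[of 1 "real W" "ln 2"] by simp
  also have "\<dots> = real W * (ln 2 + ln N0)" by (simp add: distrib_left)
  also have "\<dots> \<le> real W * (6 * (5.82 + ln ((real K + 1)\<^sup>2 / \<delta>) + ln R))"
  proof (rule mult_left_mono)
    have "ln N0 = ln 360 + ln (real K) + 6 * ln R - 2 * ln \<delta>"
      using K R \<delta> by (simp add: N0_def ln_mult ln_div ln_realpow)
    moreover have "ln (360 :: real) \<le> ln (2 ^ 9)" by simp
    then have "ln (360 :: real) \<le> 9 * ln 2" by (simp only: ln_realpow zero_less_numeral of_nat_numeral)
    moreover have "ln (real K) \<le> 12 * ln (real K + 1)"
    proof -
      have "ln (real K) \<le> ln (real K + 1)" "0 \<le> ln (real K + 1)" using K by auto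
      then show ?thesis by linarith
    qed
    moreover have "ln ((real K + 1)\<^sup>2 / \<delta>) = 2 * ln (real K + 1) - ln \<delta>"
      using K \<delta> by (simp add: ln_div ln_realpow)
    moreover have "ln \<delta> \<le> 0" using \<delta> by simp
    ultimately show "ln 2 + ln N0 \<le> 6 * (5.82 + ln ((real K + 1)\<^sup>2 / \<delta>) + ln R)"
      using l2 by simp
  qed simp
  finally show "ln (2 * (360 * real K * R ^ 6 / \<delta>\<^sup>2) ^ W) \<le> 6 * real W * (5.82 + ln ((real K + 1)\<^sup>2 / \<delta>) + ln R)"
    by (simp only: N0_def mult.assoc mult.left_commute)
qed

lemma rho_dim_le:
  assumes B: "1 \<le> B" and w: "\<And>y. 0 < y \<Longrightarrow> B < rho_beta\<^sup>2 * y\<^sup>2 \<Longrightarrow> rho_w n P Pbar p \<Q> q y \<le> ennreal (rho_a1 * y\<^sup>2 / 8)"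
  shows "rho_dim n P Pbar p \<Q> q \<le> ennreal B"
proof -
  have \<beta>: "0 < rho_beta\<^sup>2" by (simp add: rho_beta_def rho_a1_def rho_a2_def)
  have "Sup {ennreal (y\<^sup>2) | y. 0 < y \<and> rho_w n P Pbar p \<Q> q y > ennreal (rho_a1 * y\<^sup>2 / 8)} \<le> ennreal (B / rho_beta\<^sup>2)"
  proof (rule Sup_least)
    fix z assume "z \<in> {ennreal (y\<^sup>2) | y. 0 < y \<and> rho_w n P Pbar p \<Q> q y > ennreal (rho_a1 * y\<^sup>2 / 8)}"
    then obtain y where y: "z = ennreal (y\<^sup>2)" "0 < y" "rho_w n P Pbar p \<Q> q y > ennreal (rho_a1 * y\<^sup>2 / 8)" by blast
    then have "rho_beta\<^sup>2 * y\<^sup>2 \<le> B" using w[OF y(2)] by (meson leD not_le)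
    then show "z \<le> ennreal (B / rho_beta\<^sup>2)"
      unfolding y(1) using \<beta> by (intro ennreal_leI) (simp add: pos_le_divide_eq mult.commute)
  qed
  then have "ennreal (rho_beta\<^sup>2) * Sup {ennreal (y\<^sup>2) | y. 0 < y \<and> rho_w n P Pbar p \<Q> q y > ennreal (rho_a1 * y\<^sup>2 / 8)}
      \<le> ennreal (rho_beta\<^sup>2) * ennreal (B / rho_beta\<^sup>2)"
    by (rule mult_left_mono) simp
  also have "\<dots> = ennreal B" using \<beta> B by (subst ennreal_mult[symmetric]) auto
  finally show ?thesis
    unfolding rho_dim_def using B by (intro max.boundedI) (auto simp: ennreal_1[symmetric] simp del: ennreal_1)
qed

lemma rho_beta_sq_le: "rho_beta\<^sup>2 \<le> 9 / 3072"
proof -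
  have "rho_beta\<^sup>2 = 9 / (3072 * sqrt 2)"
    by (simp add: rho_beta_def rho_a1_def rho_a2_def power_divide power_mult_distrib)
  also have "\<dots> \<le> 9 / (3072 * 1)" by (intro divide_left_mono mult_left_mono) auto
  finally show ?thesis by simp
qed

theorem proposition3:
  fixes \<mu> :: "'a measure"
    and \<Lambda> :: "nat \<Rightarrow> 'l set"
    and \<F> :: "nat \<Rightarrow> 'l \<Rightarrow> ('a \<Rightarrow> real) set"
    and F :: "nat \<Rightarrow> 'l \<Rightarrow> 'a measure set"
    and \<Theta> :: "(nat \<times> (nat \<Rightarrow> 'l)) set"
    and \<delta> :: "nat \<times> (nat \<Rightarrow> 'l) \<Rightarrow> real"
    and K :: nat and l :: "nat \<Rightarrow> 'l"
    and n :: nat and P :: "nat \<Rightarrow> 'a measure" and Pbar :: "'a measure"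
    and \<nu> :: "'a measure" and p :: "'a \<Rightarrow> real" and q :: "'a measure \<Rightarrow> 'a \<Rightarrow> real"
  assumes "sigma_finite_measure \<mu>"
    and "\<And>k. 1 \<le> k \<Longrightarrow> countable (\<Lambda> k)"
    and "\<And>k m f. 1 \<le> k \<Longrightarrow> m \<in> \<Lambda> k \<Longrightarrow> f \<in> \<F> k m \<Longrightarrow>
           f \<in> borel_measurable \<mu> \<and> (\<forall>x\<in>space \<mu>. 0 \<le> f x) \<and> density \<mu> f \<in> space (prob_algebra \<mu>)"
    and "\<And>k m. 1 \<le> k \<Longrightarrow> m \<in> \<Lambda> k \<Longrightarrow> vc_subgraph (space \<mu>) (\<F> k m)"
    and "\<And>k m. 1 \<le> k \<Longrightarrow> m \<in> \<Lambda> k \<Longrightarrow>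
           countable (F k m) \<and> hellinger_dense (F k m) {density \<mu> f | f. f \<in> \<F> k m}"
    and "\<Theta> \<subseteq> (SIGMA K:{1..}. PiE {1..K} \<Lambda>)"
    and "\<And>\<theta>. \<theta> \<in> \<Theta> \<Longrightarrow> \<delta> \<theta> \<in> {0<..1 / real (fst \<theta>)}"
    and "(K, l) \<in> \<Theta>"
    and "1 \<le> n"
    and "\<And>i. i < n \<Longrightarrow> P i \<in> space (prob_algebra \<mu>)"
    and "Pbar \<in> space (prob_algebra \<mu>)"
    and "sigma_finite_measure \<nu>" and "sets \<nu> = sets \<mu>"
    and "is_density \<nu> Pbar p"
    and "\<And>Q. Q \<in> mixture_model \<mu> F \<delta> (K, l) \<Longrightarrow> is_density \<nu> Q (q Q)"
    and "model_densities \<mu> \<F> F \<delta> (K, l) n P q"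
  shows "let V = real (\<Sum>k=1..K. vc_index (space \<mu>) (\<F> k (l k)))
         in rho_dim n P Pbar p (mixture_model \<mu> F \<delta> (K, l)) q
              \<le> ennreal (818.1 * V *
                   (5.82 + ln ((real K + 1)\<^sup>2 / \<delta> (K, l)) + log_plus (real n / V)))"
proof -
  note \<F> = assms(3) and vc = assms(4) and dense = assms(5)
  note P = assms(10) and Pbar = assms(11) and sets = assms(13) and p = assms(14) and q = assms(15) and model = assms(16)
  have l: "l k \<in> \<Lambda> k" if "k \<in> {1..K}" for k
    using assms(6,8) that by (auto simp: PiE_def Pi_def)
  have K: "1 \<le> K" using assms(6,8) by auto
  define d where "d = \<delta> (K, l)"
  have d: "0 < d" "d \<le> 1"
  proof -
    have "0 < d" "d \<le> 1 / real K" using assms(7)[OF assms(8)] by (auto simp: d_def)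
    moreover have "1 / real K \<le> 1" using K by simp
    ultimately show "0 < d" "d \<le> 1" by linarith+
  qed
  define V where "V k = vc_index (space \<mu>) (\<F> k (l k))" for k
  have V: "1 \<le> V k" "shatters_none_of_size (subgraph (space \<mu>) ` \<F> k (l k)) (V k)" if k: "k \<in> {1..K}" for k
  proof -
    have "vc_subgraph (space \<mu>) (\<F> k (l k))" using vc l[OF k] k by auto
    then have "1 \<le> V k \<and> shatters_none_of_size (subgraph (space \<mu>) ` \<F> k (l k)) (V k)"
      unfolding vc_subgraph_def V_def vc_index_def by (auto intro: LeastI2_ex)
    then show "1 \<le> V k" "shatters_none_of_size (subgraph (space \<mu>) ` \<F> k (l k)) (V k)" by auto
  qed
  define W where "W = (\<Sum>k=1..K. V k)"
  have W: "1 \<le> W"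
    using sum_mono[of "{1..K}" "\<lambda>_. 1" V] V(1) K by (simp add: W_def)
  \<comment> \<open>The resolution is \<open>1 / R\<close>, which keeps the discretization error \<open>n / R\<close> below \<open>W\<close> and has \<open>ln R = log\<^sub>+ (n / W)\<close>.\<close>
  define R where "R = max 1 (real n / real W)"
  have R: "1 \<le> R" "real n \<le> real W * R"
  proof -
    show "1 \<le> R" by (simp add: R_def)
    have "real n / real W \<le> R" by (simp add: R_def)
    then show "real n \<le> real W * R" using W by (simp add: pos_divide_le_eq mult.commute)
  qed
  have lnR: "ln R = log_plus (real n / real W)"
    using assms(9) W by (auto simp: R_def log_plus_def max_def)
  define L where "L = 5.82 + ln ((real K + 1)\<^sup>2 / d) + ln R"
  have L: "5.82 \<le> L"
  proof -
    have "d \<le> (real K + 1)\<^sup>2" using d by (smt (verit) of_nat_0_le_iff one_le_power)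
    then have "0 \<le> ln ((real K + 1)\<^sup>2 / d)" using d by (simp add: pos_le_divide_eq)
    then show ?thesis using R(1) by (simp add: L_def)
  qed
  define \<Q> where "\<Q> = mixture_model \<mu> F \<delta> (K, l)"
  define N where "N = (360 * real K * R ^ 6 / d\<^sup>2) ^ W"
  have N: "1 \<le> N" "ln (2 * N) \<le> 6 * real W * L"
    unfolding N_def L_def using ln_net_size_le[OF K W R(1) d] by auto
  have sp: "space \<nu> = space \<mu>" using sets by (rule sets_eq_imp_space_eq)
  define represents where "represents g Q w f \<longleftrightarrow> w \<in> rational_weights d K
      \<and> (\<forall>k\<in>{1..K}. f k \<in> \<F> k (l k) \<and> density \<mu> (f k) \<in> F k (l k))
      \<and> Q = mixture \<mu> K w (\<lambda>k. density \<mu> (f k))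
      \<and> (\<forall>i<n. AE x in P i. q Q x = g x * (\<Sum>k=1..K. w k * f k x))" for g Q w f
  have "\<exists>g\<in>borel_measurable \<mu>. (\<forall>x\<in>space \<mu>. 0 \<le> g x) \<and> (\<forall>Q\<in>\<Q>. \<exists>w f. represents g Q w f)"
    using model unfolding model_densities_def represents_def \<Q>_def d_def prod.case Bex_def by simp
  then obtain g where g: "g \<in> borel_measurable \<mu>" "\<And>x. x \<in> space \<mu> \<Longrightarrow> 0 \<le> g x"
    and "\<forall>Q\<in>\<Q>. \<exists>w f. represents g Q w f" by blast
  then obtain w f where rep: "\<And>Q. Q \<in> \<Q> \<Longrightarrow> represents g Q (w Q) (f Q)" by metis
  have w: "w Q \<in> rational_weights d K"
    and f: "\<And>k. k \<in> {1..K} \<Longrightarrow> f Q k \<in> \<F> k (l k)"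
    and Qmix: "Q = mixture \<mu> K (w Q) (\<lambda>k. density \<mu> (f Q k))"
    and qf: "\<And>i. i < n \<Longrightarrow> AE x in P i. q Q x = g x * (\<Sum>k=1..K. w Q k * f Q k x)"
    if "Q \<in> \<Q>" for Q
    using rep[OF that] by (simp_all add: represents_def)
  have wQ: "d \<le> w Q k \<and> w Q k \<le> 1" if "Q \<in> \<Q>" "k \<in> {1..K}" for Q k
    using w[OF that(1)] that(2) by (auto simp: rational_weights_def)
  have wsum: "(\<Sum>k=1..K. w Q k) = 1" if "Q \<in> \<Q>" for Q
    using w[OF that] by (simp add: rational_weights_def)
  have fQ: "f Q k \<in> borel_measurable \<mu>" "\<And>x. x \<in> space \<mu> \<Longrightarrow> 0 \<le> f Q k x"
    "prob_space (density \<mu> (f Q k))" if "Q \<in> \<Q>" "k \<in> {1..K}" for Q k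
    using \<F>[OF _ l[OF that(2)] f[OF that]] that(2) by (auto simp: space_prob_algebra)
  have probQ: "prob_space Q" if Q: "Q \<in> \<Q>" for Q
  proof (rule prob_spaceI)
    have one: "emeasure (density \<mu> (f Q k)) (space \<mu>) = 1" if "k \<in> {1..K}" for k
      using prob_space.emeasure_space_1[OF fQ(3)[OF Q that]] by simp
    have "emeasure (mixture \<mu> K (w Q) (\<lambda>k. density \<mu> (f Q k))) (space \<mu>) = (\<Sum>k=1..K. ennreal (w Q k))"
      using one by (subst emeasure_mixture) auto
    also have "\<dots> = ennreal (\<Sum>k=1..K. w Q k)"
      using wQ[OF Q] d by (intro sum_ennreal) (meson less_imp_le order_trans)
    finally show "emeasure Q (space Q) = 1"
      using Qmix[OF Q] wsum[OF Q] by (metis ennreal_1 space_mixture)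
  qed
  have count: "countable \<Q>"
    unfolding \<Q>_def using dense l by (intro countable_mixture_model) auto
  define r where "r Q x = g x * (\<Sum>k=1..K. w Q k * f Q k x)" for Q x
  \<comment> \<open>The value \<open>\<kappa> = 1/128\<close> makes the contribution \<open>4 \<kappa> y\<^sup>2\<close> of the second moments two thirds of \<open>a\<^sub>1 y\<^sup>2 / 8\<close>.\<close>
  have bound: "rho_w n P Pbar p \<Q> q y
      \<le> ennreal (2 * (real n * (1 / R) + ln (2 * N) / (1 / 128)) + 1 / 128 * (4 * y\<^sup>2 + 8 * (real n * (1 / R) + ln (2 * N))))" for y
  proof (rule rho_w_le[where r = r and \<nu> = \<nu>])
    show "r Q \<in> borel_measurable \<nu>" if "Q \<in> \<Q>" for Q
    proof -
      have "r Q \<in> borel_measurable \<mu>"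
        unfolding r_def using g(1) fQ(1)[OF that] by (intro borel_measurable_times borel_measurable_sum) auto
      then show ?thesis using measurable_cong_sets[OF sets refl] by blast
    qed
    fix H X assume H: "H \<subseteq> \<Q>" and X: "\<And>i. i < n \<Longrightarrow> X i \<in> space \<nu>"
    show "has_net H (\<lambda>Q i. score (r Q (X i)) (p (X i))) {..<n} (1 / R) N"
      unfolding r_def N_def W_def
    proof (rule mixture_scores_has_net[where \<Omega> = "space \<mu>" and \<F> = "\<lambda>k. \<F> k (l k)"])
      show "real n \<le> real (\<Sum>k=1..K. V k) * R" using R(2) by (simp only: W_def)
      show "0 \<le> p x" if "x \<in> space \<mu>" for x using p that by (simp add: is_density_def sp)
    qed (use H X K d V wQ wsum f fQ(2) g(2) R(1) sp in auto)
  qed (use assms(9) P Pbar sets p q count probQ qf N R in \<open>auto simp: space_prob_algebra \<Q>_def r_def\<close>)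
  have "rho_dim n P Pbar p \<Q> q \<le> ennreal (818.1 * real W * L)"
  proof (rule rho_dim_le)
    have WL: "5.82 \<le> real W * L" using W L mult_mono[of 1 "real W" "5.82" L] by simp
    then show "1 \<le> 818.1 * real W * L" by simp
    \<comment> \<open>The other contributions are at most \<open>(2 + 12 * 128 + 56 / 128) W L\<close>, which is below \<open>y\<^sup>2 / 64\<close>
      once \<open>98560 W L \<le> y\<^sup>2\<close>.\<close>
    fix y :: real assume y: "818.1 * real W * L < rho_beta\<^sup>2 * y\<^sup>2"
    also have "\<dots> \<le> 9 / 3072 * y\<^sup>2" by (intro mult_right_mono rho_beta_sq_le) simp
    finally have "818.1 * (real W * L) < 9 / 3072 * y\<^sup>2" by (simp only: mult.assoc)
    then have y2: "98560 * (real W * L) \<le> y\<^sup>2" using WL by (simp add: mult.commute[of L])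
    have "real n * (1 / R) \<le> real W" using R by (simp add: pos_divide_le_eq)
    also have "\<dots> \<le> real W * L" using L W by (simp add: mult_le_cancel_left1)
    finally have nR: "real n * (1 / R) \<le> real W * L" .
    have lN: "ln (2 * N) \<le> 6 * (real W * L)" using N(2) by (simp add: mult.assoc)
    have "2 * (real n * (1 / R) + ln (2 * N) / (1 / 128)) + 1 / 128 * (4 * y\<^sup>2 + 8 * (real n * (1 / R) + ln (2 * N)))
        \<le> rho_a1 * y\<^sup>2 / 8"
    proof -
      have "2 * (a + b / (1 / 128)) + 1 / 128 * (4 * z + 8 * (a + b)) \<le> 3 / 8 * z / 8"
        if "a \<le> c" "b \<le> 6 * c" "98560 * c \<le> z" "0 \<le> c" for a b c z :: real
        using that by (simp add: field_simps)
      from this[OF nR lN y2] show ?thesis using WL by (simp add: rho_a1_def)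
    qed
    then show "rho_w n P Pbar p \<Q> q y \<le> ennreal (rho_a1 * y\<^sup>2 / 8)"
      by (intro order_trans[OF bound] ennreal_leI)
  qed
  then show ?thesis
    by (simp add: Let_def \<Q>_def W_def V_def L_def lnR d_def)
qed

end
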